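(* Let $\mathbf{C}$ be a reversal-closed super-$\mathrm{AFL}$. Let $M_1,M_2$ be $\mathbf{C}$-tabled monoids. Then the monoid free product $M_1\ast M_2$ is $\mathbf{C}$-tabled.
   Context: For a word $w=a_1\cdots a_n$ write $w^{\mathrm{rev}}=a_n\cdots a_1$, and for a language $L$ write $L^{\mathrm{rev}}=\{w^{\mathrm{rev}}\mid w\in L\}$. A class $\mathbf{C}$ of languages (over finite alphabets) is reversal-closed if $L\in\mathbf{C}$ implies $L^{\mathrm{rev}}\in\mathbf{C}$. A full $\mathrm{AFL}$ is a class of languages closed under homomorphism, inverse homomorphism, intersection with regular languages, union, concatenation, and Kleene star. A rewriting system over a finite alphabet $A$ is a subset $\mathscr{R}\subseteq A^\ast\times A^\ast$; write $u\to_{\mathscr{R}}v$ if $u=x\ell y$, $v=xry$ for some $x,y\in A^\ast$, $(\ell,r)\in\mathscr{R}$, and let $\to^\ast_{\mathscr{R}}$ be the reflexive transitive closure. It is monadic if every $(u,v)\in\mathscr{R}$ satisfies $|u|\ge|v|$ and $v\in A\cup\{\varepsilon\}$. A monadic system is $\mathbf{C}$-monadic if for every $a\in A\cup\{\varepsilon\}$ the language $\{u\mid(u,a)\in\mathscr{R}\}$ lies in $\mathbf{C}$. For $L\subseteq A^\ast$, the set of ancestors is $\nabla^\ast_{\mathscr{R}}(L)=\{w\in A^\ast\mid \exists x\in L:\ w\to^\ast_{\mathscr{R}}x\}$. $\mathbf{C}$ has the monadic ancestor property if for every finite alphabet $A$, every $\mathbf{C}$-monadic $\mathscr{R}\subseteq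 A^\ast\times A^\ast$ and every $L\subseteq A^\ast$ with $L\in\mathbf{C}$, one has $\nabla^\ast_{\mathscr{R}}(L)\in\mathbf{C}$. A super-$\mathrm{AFL}$ is a full $\mathrm{AFL}$ with the monadic ancestor property. Let $M$ be a monoid generated by a finite set $A$, with surjective homomorphism $\pi_M\colon A^\ast\to M$. A regular language $R\subseteq A^\ast$ is a language of normal forms for $M$ if every element of $M$ is represented (via $\pi_M$) by exactly one word of $R$. With $\#_1,\#_2$ new symbols, $\mathcal{T}_M(R)=\{u\#_1v\#_2w^{\mathrm{rev}}\mid u,v,w\in R,\ \pi_M(u)\pi_M(v)=\pi_M(w)\}$. $M$ is $\mathbf{C}$-tabled if (for some finite generating set $A$) there is a regular language $R\subseteq A^\ast$ of normal forms for $M$ with $\mathcal{T}_M(R)\in\mathbf{C}$. The monoid free product is the coproduct in the category of monoids. *)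

theory Defs
  imports "HOL-Algebra.Group"
begin

section \<open>Words and languages\<close>

definition free_monoid :: "'s set \<Rightarrow> 's list monoid" where
  "free_monoid A = \<lparr>carrier = lists A, mult = (@), one = []\<rparr>"

text \<open>The library's \<^const>\<open>hom\<close> does not ask for the unit to be preserved, which is automatic for
  groups but not for monoids.\<close>

definition monoid_hom :: "('a, 'm) monoid_scheme \<Rightarrow> ('b, 'n) monoid_scheme \<Rightarrow> ('a \<Rightarrow> 'b) set" where
  "monoid_hom M N = {h \<in> hom M N. h \<one>\<^bsub>M\<^esub> = \<one>\<^bsub>N\<^esub>}"

definition lang_conc :: "'s list set \<Rightarrow> 's list set \<Rightarrow> 's list set" where
  "lang_conc L K = {u @ v | u v. u \<in> L \<and> v \<in> K}"

definition lang_star :: "'s list set \<Rightarrow> 's list set" where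
  "lang_star L = {concat ws | ws. ws \<in> lists L}"

text \<open>Regular languages, as the languages denoted by regular expressions.\<close>

inductive regular :: "'s list set \<Rightarrow> bool" where
  empty: "regular {}"
| eps: "regular {[]}"
| letter: "regular {[a]}"
| union: "regular L \<Longrightarrow> regular K \<Longrightarrow> regular (L \<union> K)"
| conc: "regular L \<Longrightarrow> regular K \<Longrightarrow> regular (lang_conc L K)"
| star: "regular L \<Longrightarrow> regular (lang_star L)"


section \<open>Rewriting systems\<close>

definition rewrite_step :: "'s set \<Rightarrow> ('s list \<times> 's list) set \<Rightarrow> 's list \<Rightarrow> 's list \<Rightarrow> bool" where
  "rewrite_step A R u v \<longleftrightarrow>
     (\<exists>x\<in>lists A. \<exists>y\<in>lists A. \<exists>(l, r)\<in>R. u = x @ l @ y \<and> v = x @ r @ y)"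

definition ancestors :: "'s set \<Rightarrow> ('s list \<times> 's list) set \<Rightarrow> 's list set \<Rightarrow> 's list set" where
  "ancestors A R L = {w \<in> lists A. \<exists>x\<in>L. (rewrite_step A R)\<^sup>*\<^sup>* w x}"

definition monadic :: "'s set \<Rightarrow> ('s list \<times> 's list) set \<Rightarrow> bool" where
  "monadic A R \<longleftrightarrow> R \<subseteq> lists A \<times> lists A \<and>
     (\<forall>(u, v)\<in>R. length u \<ge> length v \<and> v \<in> insert [] {[a] | a. a \<in> A})"


section \<open>Classes of languages\<close>

text \<open>
  A class of languages is a set of languages over finite sub-alphabets of the fixed infinite
  supply \<^typ>\<open>nat\<close> of symbols. The class is not indexed by alphabets: a language belongs to it
  irrespective of which finite alphabet it is considered over. Every finite alphabet can be renamed
  into \<^typ>\<open>nat\<close>, and every class closed under homomorphism is invariant under renaming.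
\<close>

definition language_class :: "nat list set set \<Rightarrow> bool" where
  "language_class C \<longleftrightarrow> (\<forall>L\<in>C. \<exists>A. finite A \<and> L \<subseteq> lists A)"

definition reversal_closed :: "nat list set set \<Rightarrow> bool" where
  "reversal_closed C \<longleftrightarrow> (\<forall>L\<in>C. rev ` L \<in> C)"

definition full_AFL :: "nat list set set \<Rightarrow> bool" where
  "full_AFL C \<longleftrightarrow> language_class C \<and>
     (\<forall>A B h. finite A \<and> finite B \<and> h \<in> monoid_hom (free_monoid A) (free_monoid B) \<longrightarrow>
        (\<forall>L\<in>C. L \<subseteq> lists A \<longrightarrow> h ` L \<in> C) \<and>
        (\<forall>L\<in>C. L \<subseteq> lists B \<longrightarrow> {w \<in> lists A. h w \<in> L} \<in> C)) \<and>
     (\<forall>L\<in>C. \<forall>R. regular R \<longrightarrow> L \<inter> R \<in> C) \<and>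
     (\<forall>L\<in>C. \<forall>K\<in>C. L \<union> K \<in> C) \<and>
     (\<forall>L\<in>C. \<forall>K\<in>C. lang_conc L K \<in> C) \<and>
     (\<forall>L\<in>C. lang_star L \<in> C)"

definition class_monadic :: "nat list set set \<Rightarrow> nat set \<Rightarrow> (nat list \<times> nat list) set \<Rightarrow> bool" where
  "class_monadic C A R \<longleftrightarrow> monadic A R \<and>
     (\<forall>v \<in> insert [] {[a] | a. a \<in> A}. {u. (u, v) \<in> R} \<in> C)"

definition monadic_ancestor_property :: "nat list set set \<Rightarrow> bool" where
  "monadic_ancestor_property C \<longleftrightarrow>
     (\<forall>A R L. finite A \<and> class_monadic C A R \<and> L \<subseteq> lists A \<and> L \<in> C \<longrightarrow> ancestors A R L \<in> C)"

definition super_AFL :: "nat list set set \<Rightarrow> bool" where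
  "super_AFL C \<longleftrightarrow> full_AFL C \<and> monadic_ancestor_property C"


section \<open>Tabled monoids\<close>

definition normal_forms ::
    "('a, 'm) monoid_scheme \<Rightarrow> 's set \<Rightarrow> ('s list \<Rightarrow> 'a) \<Rightarrow> 's list set \<Rightarrow> bool" where
  "normal_forms M A \<pi> R \<longleftrightarrow>
     R \<subseteq> lists A \<and> regular R \<and> (\<forall>m\<in>carrier M. \<exists>!w. w \<in> R \<and> \<pi> w = m)"

definition mult_table ::
    "('a, 'm) monoid_scheme \<Rightarrow> ('s list \<Rightarrow> 'a) \<Rightarrow> 's \<Rightarrow> 's \<Rightarrow> 's list set \<Rightarrow> 's list set" where
  "mult_table M \<pi> s t R =
     {u @ [s] @ v @ [t] @ rev w | u v w. u \<in> R \<and> v \<in> R \<and> w \<in> R \<and> \<pi> u \<otimes>\<^bsub>M\<^esub> \<pi> v = \<pi> w}"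

text \<open>The generating set is an abstract finite alphabet \<^term>\<open>A\<close> whose letters name elements
  of the monoid through \<^term>\<open>\<pi>\<close>; \<^term>\<open>s\<close> and \<^term>\<open>t\<close> are the two separator symbols.\<close>

definition tabled :: "nat list set set \<Rightarrow> ('a, 'm) monoid_scheme \<Rightarrow> bool" where
  "tabled C M \<longleftrightarrow>
     (\<exists>A \<pi> R s t. finite A \<and>
        \<pi> \<in> monoid_hom (free_monoid A) M \<and> \<pi> ` lists A = carrier M \<and>
        normal_forms M A \<pi> R \<and>
        s \<notin> A \<and> t \<notin> A \<and> s \<noteq> t \<and>
        mult_table M \<pi> s t R \<in> C)"


section \<open>The free product of monoids\<close>

definition pres_class :: "'s set \<Rightarrow> ('s list \<times> 's list) set \<Rightarrow> 's list \<Rightarrow> 's list set" where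
  "pres_class A S u = {v \<in> lists A. equivclp (rewrite_step A S) u v}"

definition presented_monoid :: "'s set \<Rightarrow> ('s list \<times> 's list) set \<Rightarrow> 's list set monoid" where
  "presented_monoid A S =
     \<lparr>carrier = pres_class A S ` lists A,
      mult = (\<lambda>X Y. \<Union>u\<in>X. \<Union>v\<in>Y. pres_class A S (u @ v)),
      one = pres_class A S []\<rparr>"

text \<open>The free product is presented by the disjoint union of the multiplication tables of the
  factors, with both units identified with the empty word. It is shown below to be the coproduct.\<close>

definition free_product_rels ::
    "('a, 'm) monoid_scheme \<Rightarrow> ('b, 'n) monoid_scheme \<Rightarrow> (('a + 'b) list \<times> ('a + 'b) list) set" where
  "free_product_rels M N =
     {([Inl x, Inl y], [Inl (x \<otimes>\<^bsub>M\<^esub> y)]) | x y. x \<in> carrier M \<and> y \<in> carrier M} \<union>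
     {([Inr x, Inr y], [Inr (x \<otimes>\<^bsub>N\<^esub> y)]) | x y. x \<in> carrier N \<and> y \<in> carrier N} \<union>
     {([Inl \<one>\<^bsub>M\<^esub>], []), ([Inr \<one>\<^bsub>N\<^esub>], [])}"

definition free_product ::
    "('a, 'm) monoid_scheme \<Rightarrow> ('b, 'n) monoid_scheme \<Rightarrow> ('a + 'b) list set monoid" where
  "free_product M N = presented_monoid (carrier M <+> carrier N) (free_product_rels M N)"

definition free_product_inl ::
    "('a, 'm) monoid_scheme \<Rightarrow> ('b, 'n) monoid_scheme \<Rightarrow> 'a \<Rightarrow> ('a + 'b) list set" where
  "free_product_inl M N x = pres_class (carrier M <+> carrier N) (free_product_rels M N) [Inl x]"

definition free_product_inr ::
    "('a, 'm) monoid_scheme \<Rightarrow> ('b, 'n) monoid_scheme \<Rightarrow> 'b \<Rightarrow> ('a + 'b) list set" where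
  "free_product_inr M N y = pres_class (carrier M <+> carrier N) (free_product_rels M N) [Inr y]"


subsection \<open>Presented monoids\<close>

lemma rewrite_step_context:
  assumes "rewrite_step A S u v" "x \<in> lists A" "y \<in> lists A"
  shows "rewrite_step A S (x @ u @ y) (x @ v @ y)"
proof -
  obtain p q l r where "p \<in> lists A" "q \<in> lists A" "(l, r) \<in> S"
    and "u = p @ l @ q" "v = p @ r @ q"
    using assms(1) unfolding rewrite_step_def by blast
  then show ?thesis
    unfolding rewrite_step_def using assms(2,3)
    by (intro bexI[of _ "x @ p"] bexI[of _ "q @ y"] bexI[of _ "(l, r)"]) auto
qed

lemma equivclp_context:
  assumes "equivclp (rewrite_step A S) u v" "x \<in> lists A" "y \<in> lists A"
  shows "equivclp (rewrite_step A S) (x @ u @ y) (x @ v @ y)"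
  using assms(1)
proof (induction rule: equivclp_induct)
  case base
  show ?case by simp
next
  case (step v w)
  have "equivclp (rewrite_step A S) (x @ v @ y) (x @ w @ y)"
    using step(2) rewrite_step_context[OF _ assms(2,3)]
    by (meson equivclp_sym r_into_equivclp)
  then show ?case
    using step.IH equivclp_trans by metis
qed

lemma equivclp_append:
  assumes "equivclp (rewrite_step A S) u u'" "equivclp (rewrite_step A S) v v'"
    and "u' \<in> lists A" "v \<in> lists A"
  shows "equivclp (rewrite_step A S) (u @ v) (u' @ v')"
  using equivclp_context[OF assms(1), of "[]" v] equivclp_context[OF assms(2), of u' "[]"] assms(3,4)
  by (metis append_Nil append_Nil2 equivclp_trans lists.Nil)

lemma pres_class_self: "u \<in> lists A \<Longrightarrow> u \<in> pres_class A S u"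
  by (simp add: pres_class_def)

lemma pres_class_eqI: "equivclp (rewrite_step A S) u v \<Longrightarrow> pres_class A S u = pres_class A S v"
  unfolding pres_class_def by (metis equivclp_sym equivclp_trans)

lemma pres_class_mult:
  assumes "u \<in> lists A" "v \<in> lists A"
  shows "pres_class A S u \<otimes>\<^bsub>presented_monoid A S\<^esub> pres_class A S v = pres_class A S (u @ v)"
proof -
  have "pres_class A S (u' @ v') = pres_class A S (u @ v)"
    if "u' \<in> pres_class A S u" "v' \<in> pres_class A S v" for u' v'
    using that assms(2) equivclp_append[of A S u u' v v']
    by (metis (no_types, lifting) mem_Collect_eq pres_class_def pres_class_eqI)
  then have "(\<Union>u'\<in>pres_class A S u. \<Union>v'\<in>pres_class A S v. pres_class A S (u' @ v'))
      = pres_class A S (u @ v)"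
    using pres_class_self[OF assms(1), of S] pres_class_self[OF assms(2), of S] by blast
  then show ?thesis
    by (simp add: presented_monoid_def)
qed

lemma monoid_presented_monoid: "monoid (presented_monoid A S)"
proof -
  let ?P = "presented_monoid A S"
  have car: "carrier ?P = pres_class A S ` lists A" and one: "\<one>\<^bsub>?P\<^esub> = pres_class A S []"
    by (simp_all add: presented_monoid_def)
  show ?thesis
    by (rule monoidI)
      (simp_all add: car one image_iff Bex_def, (metis append_in_lists_conv append_assoc
        append_Nil append_Nil2 lists.Nil pres_class_mult)+)
qed

lemma presented_monoid_lift:
  assumes N: "monoid N" and f: "f \<in> monoid_hom (free_monoid A) N"
    and S: "S \<subseteq> lists A \<times> lists A" "\<And>l r. (l, r) \<in> S \<Longrightarrow> f l = f r"
  obtains h where "h \<in> monoid_hom (presented_monoid A S) N"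
    "\<And>u. u \<in> lists A \<Longrightarrow> h (pres_class A S u) = f u"
proof -
  interpret N: monoid N by (rule N)
  have app: "f (u @ v) = f u \<otimes>\<^bsub>N\<^esub> f v" if "u \<in> lists A" "v \<in> lists A" for u v
    using f that by (auto simp: monoid_hom_def hom_def free_monoid_def)
  have cl: "f u \<in> carrier N" if "u \<in> lists A" for u
    using f that by (auto simp: monoid_hom_def hom_def free_monoid_def)
  have f1: "f [] = \<one>\<^bsub>N\<^esub>"
    using f by (simp add: monoid_hom_def free_monoid_def)
  have step: "f u = f v" if "rewrite_step A S u v" for u v
  proof -
    obtain p q l r where pq: "p \<in> lists A" "q \<in> lists A" and lr: "(l, r) \<in> S"
      and uv: "u = p @ l @ q" "v = p @ r @ q"
      using \<open>rewrite_step A S u v\<close> unfolding rewrite_step_def by blast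
    have "l \<in> lists A" "r \<in> lists A" "f l = f r"
      using lr S by auto
    then show ?thesis
      using pq unfolding uv by (simp add: app)
  qed
  have inv: "f u = f v" if "equivclp (rewrite_step A S) u v" for u v
    using that by (induction rule: equivclp_induct) (auto dest: step)
  define h where "h X = f (SOME u. u \<in> X)" for X
  have h: "h (pres_class A S u) = f u" if "u \<in> lists A" for u
  proof -
    have "(SOME v. v \<in> pres_class A S u) \<in> pres_class A S u"
      using pres_class_self[OF that] by (rule someI)
    then show ?thesis
      unfolding h_def pres_class_def using inv by auto
  qed
  have "h \<in> monoid_hom (presented_monoid A S) N"
  proof -
    let ?P = "presented_monoid A S"
    have car: "carrier ?P = pres_class A S ` lists A" and one: "\<one>\<^bsub>?P\<^esub> = pres_class A S []"
      by (simp_all add: presented_monoid_def)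
    have "h (X \<otimes>\<^bsub>?P\<^esub> Y) = h X \<otimes>\<^bsub>N\<^esub> h Y" if XY: "X \<in> carrier ?P" "Y \<in> carrier ?P" for X Y
    proof -
      obtain u v where uv: "u \<in> lists A" "v \<in> lists A"
        and X: "X = pres_class A S u" and Y: "Y = pres_class A S v"
        using XY unfolding car by blast
      then have "u @ v \<in> lists A" by simp
      then show ?thesis
        using uv by (simp add: X Y pres_class_mult h app)
    qed
    moreover have "h \<in> carrier ?P \<rightarrow> carrier N"
      unfolding car using h cl by (auto simp: in_lists_conv_set)
    moreover have "h \<one>\<^bsub>?P\<^esub> = \<one>\<^bsub>N\<^esub>"
      unfolding one using h[of "[]"] f1 by simp
    ultimately show ?thesis
      by (simp add: monoid_hom_def hom_def)
  qed
  with h that show ?thesis by blast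
qed


subsection \<open>The universal property of the free product\<close>

lemma monoid_free_product: "monoid (free_product M N)"
  by (simp add: free_product_def monoid_presented_monoid)

lemma free_product_rel_step:
  assumes "(l, r) \<in> free_product_rels M N"
  shows "pres_class (carrier M <+> carrier N) (free_product_rels M N) l
       = pres_class (carrier M <+> carrier N) (free_product_rels M N) r"
proof -
  have "rewrite_step (carrier M <+> carrier N) (free_product_rels M N) l r"
    unfolding rewrite_step_def using assms
    by (intro bexI[of _ "[]"] bexI[of _ "(l, r)"]) auto
  then show ?thesis
    by (intro pres_class_eqI r_into_equivclp)
qed

lemma free_product_inl_hom: "free_product_inl M N \<in> monoid_hom M (free_product M N)"
proof -
  let ?A = "carrier M <+> carrier N" and ?S = "free_product_rels M N"
  have "free_product_inl M N (x \<otimes>\<^bsub>M\<^esub> y) =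
      free_product_inl M N x \<otimes>\<^bsub>free_product M N\<^esub> free_product_inl M N y"
    if "x \<in> carrier M" "y \<in> carrier M" for x y
  proof -
    have "pres_class ?A ?S [Inl x, Inl y] = pres_class ?A ?S [Inl (x \<otimes>\<^bsub>M\<^esub> y)]"
      by (rule free_product_rel_step) (use that in \<open>auto simp: free_product_rels_def\<close>)
    then show ?thesis
      using that pres_class_mult[of "[Inl x]" ?A "[Inl y]" ?S]
      by (simp add: free_product_inl_def free_product_def InlI)
  qed
  moreover have "free_product_inl M N \<one>\<^bsub>M\<^esub> = \<one>\<^bsub>free_product M N\<^esub>"
    using free_product_rel_step[of "[Inl \<one>\<^bsub>M\<^esub>]" "[]" M N]
    by (simp add: free_product_inl_def free_product_def presented_monoid_def free_product_rels_def)
  ultimately show ?thesis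
    by (auto simp: monoid_hom_def hom_def free_product_inl_def free_product_def presented_monoid_def)
qed

lemma free_product_inr_hom: "free_product_inr M N \<in> monoid_hom N (free_product M N)"
proof -
  let ?A = "carrier M <+> carrier N" and ?S = "free_product_rels M N"
  have "free_product_inr M N (x \<otimes>\<^bsub>N\<^esub> y) =
      free_product_inr M N x \<otimes>\<^bsub>free_product M N\<^esub> free_product_inr M N y"
    if "x \<in> carrier N" "y \<in> carrier N" for x y
  proof -
    have "pres_class ?A ?S [Inr x, Inr y] = pres_class ?A ?S [Inr (x \<otimes>\<^bsub>N\<^esub> y)]"
      by (rule free_product_rel_step) (use that in \<open>auto simp: free_product_rels_def\<close>)
    then show ?thesis
      using that pres_class_mult[of "[Inr x]" ?A "[Inr y]" ?S]
      by (simp add: free_product_inr_def free_product_def InrI)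
  qed
  moreover have "free_product_inr M N \<one>\<^bsub>N\<^esub> = \<one>\<^bsub>free_product M N\<^esub>"
    using free_product_rel_step[of "[Inr \<one>\<^bsub>N\<^esub>]" "[]" M N]
    by (simp add: free_product_inr_def free_product_def presented_monoid_def free_product_rels_def)
  ultimately show ?thesis
    by (auto simp: monoid_hom_def hom_def free_product_inr_def free_product_def presented_monoid_def)
qed

theorem free_product_coproduct_exists:
  assumes M: "monoid M" and N: "monoid N" and Q: "monoid Q"
    and f: "f \<in> monoid_hom M Q" and g: "g \<in> monoid_hom N Q"
  shows "\<exists>h \<in> monoid_hom (free_product M N) Q.
    (\<forall>x\<in>carrier M. h (free_product_inl M N x) = f x) \<and>
    (\<forall>y\<in>carrier N. h (free_product_inr M N y) = g y)"
proof -
  interpret M: monoid M by (rule M)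
  interpret N: monoid N by (rule N)
  interpret Q: monoid Q by (rule Q)
  let ?A = "carrier M <+> carrier N" and ?S = "free_product_rels M N"
  define k where "k w = foldr (\<lambda>a q. case_sum f g a \<otimes>\<^bsub>Q\<^esub> q) w \<one>\<^bsub>Q\<^esub>" for w
  have f_cl: "f x \<in> carrier Q" if "x \<in> carrier M" for x
    using f that by (auto simp: monoid_hom_def hom_def)
  have g_cl: "g x \<in> carrier Q" if "x \<in> carrier N" for x
    using g that by (auto simp: monoid_hom_def hom_def)
  have k_cl: "k w \<in> carrier Q" if "w \<in> lists ?A" for w
    using that by (induction w) (auto simp: k_def f_cl g_cl)
  have k_app: "k (u @ v) = k u \<otimes>\<^bsub>Q\<^esub> k v" if "u \<in> lists ?A" "v \<in> lists ?A" for u v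
    using that(1)
  proof (induction u)
    case Nil
    then show ?case using k_cl[OF that(2)] by (simp add: k_def)
  next
    case (Cons a u)
    have "case_sum f g a \<in> carrier Q"
      using Cons(1) f_cl g_cl by auto
    then show ?case
      using Cons(3) Q.m_assoc[OF _ k_cl[OF Cons(2)] k_cl[OF that(2)]] by (simp add: k_def)
  qed
  have k_hom: "k \<in> monoid_hom (free_monoid ?A) Q"
    using k_cl k_app by (auto simp: monoid_hom_def hom_def free_monoid_def k_def)
  have S_sub: "?S \<subseteq> lists ?A \<times> lists ?A"
    by (auto simp: free_product_rels_def)
  have S_eq: "k l = k r" if "(l, r) \<in> ?S" for l r
    using that f g f_cl g_cl
    by (auto simp: free_product_rels_def k_def monoid_hom_def hom_def)
  obtain h where h: "h \<in> monoid_hom (presented_monoid ?A ?S) Q"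
    and hk: "\<And>u. u \<in> lists ?A \<Longrightarrow> h (pres_class ?A ?S u) = k u"
    using presented_monoid_lift[OF Q k_hom S_sub S_eq] by blast
  show ?thesis
  proof (intro bexI conjI ballI)
    show "h \<in> monoid_hom (free_product M N) Q"
      using h by (simp add: free_product_def)
    show "h (free_product_inl M N x) = f x" if "x \<in> carrier M" for x
      using that hk[of "[Inl x]"] f_cl by (simp add: free_product_inl_def k_def InlI)
    show "h (free_product_inr M N y) = g y" if "y \<in> carrier N" for y
      using that hk[of "[Inr y]"] g_cl by (simp add: free_product_inr_def k_def InrI)
  qed
qed

theorem free_product_coproduct_unique:
  assumes h: "h \<in> monoid_hom (free_product M N) Q" and h': "h' \<in> monoid_hom (free_product M N) Q"
    and l: "\<And>x. x \<in> carrier M \<Longrightarrow> h (free_product_inl M N x) = h' (free_product_inl M N x)"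
    and r: "\<And>y. y \<in> carrier N \<Longrightarrow> h (free_product_inr M N y) = h' (free_product_inr M N y)"
    and X: "X \<in> carrier (free_product M N)"
  shows "h X = h' X"
proof -
  let ?A = "carrier M <+> carrier N" and ?S = "free_product_rels M N"
  have "h (pres_class ?A ?S w) = h' (pres_class ?A ?S w)" if "w \<in> lists ?A" for w
    using that
  proof (induction w)
    case Nil
    then show ?case
      using h h' by (simp add: monoid_hom_def free_product_def presented_monoid_def)
  next
    case (Cons a w)
    have a: "[a] \<in> lists ?A" using Cons(1) by simp
    have eq: "pres_class ?A ?S (a # w) =
        pres_class ?A ?S [a] \<otimes>\<^bsub>free_product M N\<^esub> pres_class ?A ?S w"
      using pres_class_mult[OF a Cons(2), of ?S] by (simp add: free_product_def)
    have car: "pres_class ?A ?S v \<in> carrier (free_product M N)" if "v \<in> lists ?A" for v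
      using that by (simp add: free_product_def presented_monoid_def)
    have "h (pres_class ?A ?S [a]) = h' (pres_class ?A ?S [a])"
      using Cons(1) l r by (auto simp: free_product_inl_def free_product_inr_def)
    then show ?case
      unfolding eq using h h' car[OF a] car[OF Cons(2)] Cons(3)
      by (simp add: monoid_hom_def hom_def)
  qed
  then show ?thesis
    using X by (auto simp: free_product_def presented_monoid_def)
qed

text \<open>Being tabled is invariant under isomorphism, so it does not matter by which model of the
  coproduct the free product is represented.\<close>

lemma tabled_iso:
  assumes M: "monoid M" and f: "f \<in> monoid_hom M N" and bij: "bij_betw f (carrier M) (carrier N)"
    and tab: "tabled C M"
  shows "tabled C N"
proof -
  interpret M: monoid M by (rule M)
  obtain A \<pi> R s t where fin: "finite A" and \<pi>: "\<pi> \<in> monoid_hom (free_monoid A) M"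
    and surj: "\<pi> ` lists A = carrier M" and nf: "normal_forms M A \<pi> R"
    and st: "s \<notin> A" "t \<notin> A" "s \<noteq> t" and T: "mult_table M \<pi> s t R \<in> C"
    using tab unfolding tabled_def by (elim exE conjE)
  have cl: "\<pi> w \<in> carrier M" if "w \<in> lists A" for w
    using imageI[OF that, of \<pi>] by (simp only: surj)
  have R: "R \<subseteq> lists A" "regular R"
    using nf by (simp_all add: normal_forms_def)
  have uniq: "\<exists>!w. w \<in> R \<and> \<pi> w = m" if "m \<in> carrier M" for m
    using nf that by (simp add: normal_forms_def)
  have RA: "w \<in> lists A" if "w \<in> R" for w
    using R(1) that by (rule subsetD)
  have inj: "f x = f y \<longleftrightarrow> x = y" if "x \<in> carrier M" "y \<in> carrier M" for x y
    using inj_on_eq_iff[OF bij_betw_imp_inj_on[OF bij] that] .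
  have img: "f ` carrier M = carrier N"
    using bij by (simp add: bij_betw_def)
  have "f \<circ> \<pi> \<in> monoid_hom (free_monoid A) N"
    using f \<pi> cl by (simp add: monoid_hom_def hom_def free_monoid_def Pi_def)
  moreover have "(f \<circ> \<pi>) ` lists A = carrier N"
    by (simp only: image_comp[symmetric] surj img)
  moreover have "normal_forms N A (f \<circ> \<pi>) R"
  proof -
    have "\<exists>!w. w \<in> R \<and> (f \<circ> \<pi>) w = n" if n: "n \<in> carrier N" for n
    proof -
      obtain m where m: "m \<in> carrier M" "n = f m"
        using n img by blast
      have "w \<in> R \<and> (f \<circ> \<pi>) w = n \<longleftrightarrow> w \<in> R \<and> \<pi> w = m" for w
        by (rule conj_cong[OF refl]) (simp add: m(2) inj[OF cl[OF RA] m(1)])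
      then show ?thesis
        using uniq[OF m(1)] by simp
    qed
    then show ?thesis
      using R by (simp add: normal_forms_def)
  qed
  moreover have "mult_table N (f \<circ> \<pi>) s t R = mult_table M \<pi> s t R"
  proof -
    have "(f \<circ> \<pi>) u \<otimes>\<^bsub>N\<^esub> (f \<circ> \<pi>) v = (f \<circ> \<pi>) w \<longleftrightarrow> \<pi> u \<otimes>\<^bsub>M\<^esub> \<pi> v = \<pi> w"
      if "u \<in> R" "v \<in> R" "w \<in> R" for u v w
    proof -
      have c: "\<pi> u \<in> carrier M" "\<pi> v \<in> carrier M" "\<pi> w \<in> carrier M"
        using that by (simp_all add: RA cl)
      then have "f (\<pi> u) \<otimes>\<^bsub>N\<^esub> f (\<pi> v) = f (\<pi> u \<otimes>\<^bsub>M\<^esub> \<pi> v)"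
        using f by (simp add: monoid_hom_def hom_def)
      then show ?thesis
        using inj[OF M.m_closed[OF c(1,2)] c(3)] by simp
    qed
    then show ?thesis
      unfolding mult_table_def by (intro Collect_cong iff_exI conj_cong refl) auto
  qed
  ultimately show ?thesis
    unfolding tabled_def using fin st T
    by (intro exI[of _ A] exI[of _ "f \<circ> \<pi>"] exI[of _ R] exI[of _ s] exI[of _ t]) simp
qed

end

theory Submission
  imports Defs
begin

text \<open>
  Elements of the free product correspond to alternating words of non-unit elements of the factors
  (van der Waerden's argument: the letters act on such words), so concatenating the given normal
  forms yields a regular language of normal forms. The product of \<open>u\<close> and \<open>v\<close> is computed by
  cancelling syllables around the first separator, merging at most one pair of syllables, and
  copying the rest; the monadic system \<open>rules\<close> below runs this computation on
  \<open>u #\<^sub>1 v #\<^sub>2 w\<^sup>r\<^sup>e\<^sup>v\<close>. The rules may also be applied in unintended places, for instance to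
  a mere suffix of a syllable, but every rule is sound with respect to evaluation in the free
  product, so intersecting the ancestors of a single symbol with the words of the right shape gives
  exactly the multiplication table.
\<close>

section \<open>Regular languages\<close>

text \<open>A monadic rule produces at most one symbol, whereas the product of two syllables is a
  word of unbounded length. A single rule can nevertheless absorb two syllables together with the
  mirrored normal form of their product, and the table of a factor is exactly such a set of
  left-hand sides. The pairs of syllables with product 1 come from the same table: they belong to
  the entries that end in the mirrored normal form of the unit, and stripping this fixed ending is a
  right quotient by a word. The normal form of a unit need not be empty, so it is removed from
  \<open>R\<close> and \<open>S\<close> before syllables are concatenated; otherwise an element
  could have several representatives. As \<open>regular\<close> is generated by union, concatenation
  and star, this removal goes through derivatives. Finally, the empty class of languages satisfies
  all closure conditions vacuously, so a nonempty member has to be exhibited; every table has the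
  entry for 1 times 1.\<close>

lemma lang_star_induct [consumes 1, case_names Nil append]:
  assumes "w \<in> lang_star L" "P []" "\<And>u v. u \<in> L \<Longrightarrow> v \<in> lang_star L \<Longrightarrow> P v \<Longrightarrow> P (u @ v)"
  shows "P w"
proof -
  obtain ws where ws: "ws \<in> lists L" "w = concat ws"
    using assms(1) unfolding lang_star_def by blast
  from ws(1) have "P (concat ws)"
  proof induction
    case Nil
    then show ?case using assms(2) by simp
  next
    case (Cons u us)
    then have "concat us \<in> lang_star L"
      unfolding lang_star_def by blast
    with Cons show ?case using assms(3) by simp
  qed
  with ws(2) show ?thesis by simp
qed

lemma Nil_in_lang_star [simp]: "[] \<in> lang_star L"
  unfolding lang_star_def by (rule CollectI, rule exI[of _ "[]"]) simp

lemma append_in_lang_star: "u \<in> L \<Longrightarrow> v \<in> lang_star L \<Longrightarrow> u @ v \<in> lang_star L"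
  unfolding lang_star_def
  by (clarsimp, rule_tac x = "u # ws" in exI) auto

lemma append_in_lang_conc: "u \<in> L \<Longrightarrow> v \<in> K \<Longrightarrow> u @ v \<in> lang_conc L K"
  unfolding lang_conc_def by blast

lemma append_in_lang_star_right:
  assumes "v \<in> lang_star L" "u \<in> L"
  shows "v @ u \<in> lang_star L"
  using assms(1)
proof (induction rule: lang_star_induct)
  case Nil
  then show ?case using append_in_lang_star[OF assms(2) Nil_in_lang_star] by simp
next
  case (append x y)
  then show ?case using append_in_lang_star by fastforce
qed

lemma image_lang_star:
  assumes "f [] = []" "\<And>u v. f (u @ v) = f u @ f v"
  shows "f ` lang_star L = lang_star (f ` L)"
proof (intro subset_antisym subsetI)
  fix w assume "w \<in> f ` lang_star L"
  then obtain u where "u \<in> lang_star L" "w = f u" by blast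
  then show "w \<in> lang_star (f ` L)"
    by (induction arbitrary: w rule: lang_star_induct) (auto simp: assms append_in_lang_star)
next
  fix w assume "w \<in> lang_star (f ` L)"
  then show "w \<in> f ` lang_star L"
  proof (induction rule: lang_star_induct)
    case Nil
    then show ?case using assms(1) Nil_in_lang_star by (metis image_eqI)
  next
    case (append u v)
    then obtain x y where "x \<in> L" "y \<in> lang_star L" "u = f x" "v = f y" by blast
    then show ?case
      using assms(2) append_in_lang_star by (metis image_eqI)
  qed
qed

lemma image_lang_conc:
  assumes "\<And>u v. f (u @ v) = f u @ f v"
  shows "f ` lang_conc L K = lang_conc (f ` L) (f ` K)"
proof (intro subset_antisym subsetI)
  fix w assume "w \<in> lang_conc (f ` L) (f ` K)"
  then obtain u v where "u \<in> L" "v \<in> K" "w = f (u @ v)"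
    unfolding lang_conc_def using assms by auto
  then show "w \<in> f ` lang_conc L K"
    using append_in_lang_conc by blast
qed (auto simp: lang_conc_def assms, blast)

lemma regular_map: "regular L \<Longrightarrow> regular (map f ` L)"
proof (induction rule: regular.induct)
  case (union L K)
  then show ?case by (simp add: image_Un regular.union)
next
  case (conc L K)
  have "map f ` lang_conc L K = lang_conc (map f ` L) (map f ` K)"
    by (rule image_lang_conc) simp
  then show ?case using conc by (simp add: regular.conc)
next
  case (star L)
  then show ?case by (simp add: image_lang_star regular.star)
qed (simp_all add: regular.intros)

lemma regular_rev: "regular L \<Longrightarrow> regular (rev ` L)"
proof (induction rule: regular.induct)
  case (union L K)
  then show ?case by (simp add: image_Un regular.union)
next
  case (conc L K)
  have "rev ` lang_conc L K = lang_conc (rev ` K) (rev ` L)"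
  proof (intro subset_antisym subsetI)
    fix w assume "w \<in> lang_conc (rev ` K) (rev ` L)"
    then obtain u v where "u \<in> L" "v \<in> K" "w = rev (u @ v)"
      unfolding lang_conc_def by auto
    then show "w \<in> rev ` lang_conc L K"
      using append_in_lang_conc by blast
  qed (auto simp: lang_conc_def, blast)
  then show ?case using conc by (simp add: regular.conc)
next
  case (star L)
  \<comment> \<open>\<open>L\<close> is generalised so that the fact applies both to the given
    language and to its mirror image; since reversal is an involution, the second use gives the
    converse inclusion.\<close>
  have 1: "rev w \<in> lang_star (rev ` L)" if "w \<in> lang_star L" for w and L :: "'a list set"
    using that by (induction rule: lang_star_induct) (simp_all add: append_in_lang_star_right)
  have "rev ` lang_star L = lang_star (rev ` L)"
  proof (intro subset_antisym subsetI)
    fix w assume "w \<in> lang_star (rev ` L)"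
    then have "rev w \<in> lang_star (rev ` rev ` L)" by (rule 1)
    then have "rev w \<in> lang_star L" by (simp add: image_image)
    then show "w \<in> rev ` lang_star L" by (metis image_eqI rev_rev_ident)
  qed (auto simp: 1)
  then show ?case using star by (simp add: regular.star)
qed (simp_all add: regular.intros)

lemma regular_UN: "finite I \<Longrightarrow> (\<And>i. i \<in> I \<Longrightarrow> regular (L i)) \<Longrightarrow> regular (\<Union>i\<in>I. L i)"
  by (induction rule: finite_induct) (simp_all add: regular.intros)

lemma regular_singleton: "regular {w}"
proof (induction w)
  case Nil
  then show ?case by (rule regular.eps)
next
  case (Cons a w)
  have "{a # w} = lang_conc {[a]} {w}" by (simp add: lang_conc_def)
  then show ?case using Cons by (simp add: regular.intros)
qed

lemma regular_finite: "finite L \<Longrightarrow> regular L"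
  using regular_UN[of L "\<lambda>w. {w}"] by (simp add: regular_singleton)

lemma regular_lists:
  assumes "finite A" shows "regular (lists A)"
proof -
  have "lists A = lang_star ((\<lambda>a. [a]) ` A)"
  proof (intro subset_antisym subsetI)
    fix w assume "w \<in> lists A"
    then show "w \<in> lang_star ((\<lambda>a. [a]) ` A)"
    proof induction
      case (Cons a w)
      then show ?case using append_in_lang_star[of "[a]" _ w] by simp
    qed simp
  next
    fix w assume "w \<in> lang_star ((\<lambda>a. [a]) ` A)"
    then show "w \<in> lists A"
      by (induction rule: lang_star_induct) auto
  qed
  then show ?thesis using assms by (simp add: regular.star regular_finite)
qed

section \<open>Left quotients by a letter and removal of a single word\<close>

lemma regular_derivative: "regular L \<Longrightarrow> regular {w. a # w \<in> L}"
proof (induction rule: regular.induct)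
  case (letter b)
  have "{w. a # w \<in> {[b]}} = (if a = b then {[]} else {})" by auto
  then show ?case by (simp add: regular.intros)
next
  case (union L K)
  have "{w. a # w \<in> L \<union> K} = {w. a # w \<in> L} \<union> {w. a # w \<in> K}" by auto
  then show ?case using union by (simp add: regular.union)
next
  case (conc L K)
  have "{w. a # w \<in> lang_conc L K} =
      lang_conc {w. a # w \<in> L} K \<union> (if [] \<in> L then {w. a # w \<in> K} else {})"
    unfolding lang_conc_def by (auto simp: Cons_eq_append_conv)
  then show ?case using conc by (simp add: regular.intros)
next
  case (star L)
  \<comment> \<open>Stated for \<open>x\<close> with head \<open>a\<close> instead of
    \<open>a # w\<close>, so that induction over the star applies. An empty first factor is skipped
    by the induction hypothesis; a nonempty one starts with \<open>a\<close>.\<close>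
  have 1: "\<exists>u v. a # u \<in> L \<and> v \<in> lang_star L \<and> tl x = u @ v"
    if "x \<in> lang_star L" "x \<noteq> []" "hd x = a" for x
    using that
  proof (induction rule: lang_star_induct)
    case (append u v)
    then show ?case by (cases u) auto
  qed simp
  have "{w. a # w \<in> lang_star L} = lang_conc {w. a # w \<in> L} (lang_star L)"
    (is "_ = ?K")
  proof (intro subset_antisym subsetI)
    fix w assume "w \<in> {w. a # w \<in> lang_star L}"
    then show "w \<in> ?K" using 1[of "a # w"] unfolding lang_conc_def by auto
  next
    fix w assume "w \<in> ?K"
    then show "w \<in> {w. a # w \<in> lang_star L}"
      using append_in_lang_star[of "a # _" L] unfolding lang_conc_def by fastforce
  qed
  then show ?case using star by (simp add: regular.intros)
qed (simp_all add: regular.intros)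

text \<open>Sorting the words by their first letter turns the difference into a finite union in
  which only the branch of the first letter of \<open>w\<close> changes, and there the word to be
  removed is shorter. Finiteness of the alphabet keeps the union finite.\<close>

lemma regular_remove_word:
  assumes "finite A" "L \<subseteq> lists A" "regular L"
  shows "regular (L - {w})"
  using assms(2,3)
proof (induction w arbitrary: L)
  case Nil
  have "L - {[]} = (\<Union>a\<in>A. lang_conc {[a]} {w. a # w \<in> L})"
    (is "_ = ?K")
  proof (intro subset_antisym subsetI)
    fix w assume w: "w \<in> L - {[]}"
    then obtain a v where "w = a # v" by (cases w) auto
    with w Nil(1) show "w \<in> ?K" by (auto simp: lang_conc_def)
  qed (auto simp: lang_conc_def)
  then show ?case
    using assms(1) Nil by (simp add: regular_UN regular.intros regular_derivative)
next
  case (Cons b w)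
  have sub: "{v. b # v \<in> L} \<subseteq> lists A" using Cons.prems(1) by auto
  have "L - {b # w} = (if [] \<in> L then {[]} else {}) \<union>
     (\<Union>a\<in>A - {b}. lang_conc {[a]} {v. a # v \<in> L}) \<union> lang_conc {[b]} ({v. b # v \<in> L} - {w})"
    (is "_ = ?K")
  proof (intro subset_antisym subsetI)
    fix x assume x: "x \<in> L - {b # w}"
    show "x \<in> ?K"
    proof (cases x)
      case (Cons a v)
      with x \<open>L \<subseteq> lists A\<close> show ?thesis by (cases "a = b") (auto simp: lang_conc_def)
    qed (use x in simp)
  qed (auto simp: lang_conc_def split: if_splits)
  then show ?case
    using assms(1) Cons.prems(2) Cons.IH[OF sub]
    by (simp add: regular_UN regular.intros regular_derivative)
qed


section \<open>Full AFLs\<close>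

text \<open>The form in which erasing homomorphisms are supplied: a letter may be sent to the empty
  word.\<close>

lemma concat_map_hom:
  assumes "\<And>a. a \<in> A \<Longrightarrow> f a \<in> lists B"
  shows "(\<lambda>w. concat (map f w)) \<in> monoid_hom (free_monoid A) (free_monoid B)"
  using assms by (fastforce simp: monoid_hom_def hom_def free_monoid_def in_lists_conv_set)

lemma map_hom:
  assumes "g ` A \<subseteq> B"
  shows "map g \<in> monoid_hom (free_monoid A) (free_monoid B)"
  using assms by (fastforce simp: monoid_hom_def hom_def free_monoid_def in_lists_conv_set)

text \<open>A class without members satisfies every closure condition vacuously. One nonempty member
  suffices to obtain all finite languages.\<close>

locale nontrivial_full_AFL =
  fixes C :: "nat list set set"
  assumes full_AFL: "full_AFL C" and nontrivial: "\<exists>L\<in>C. L \<noteq> {}"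
begin

lemmas closure_properties = full_AFL[unfolded full_AFL_def]

lemma finite_alphabet: "L \<in> C \<Longrightarrow> \<exists>A. finite A \<and> L \<subseteq> lists A"
  using closure_properties[THEN conjunct1] by (simp add: language_class_def)

lemma hom_image:
  assumes "finite A" "finite B" "h \<in> monoid_hom (free_monoid A) (free_monoid B)" "L \<in> C" "L \<subseteq> lists A"
  shows "h ` L \<in> C"
  by (rule closure_properties[THEN conjunct2, THEN conjunct1, THEN spec, THEN spec, THEN spec,
      THEN mp, THEN conjunct1, THEN bspec, THEN mp, of A B]) (use assms in simp_all)

lemma hom_vimage:
  assumes "finite A" "finite B" "h \<in> monoid_hom (free_monoid A) (free_monoid B)" "L \<in> C" "L \<subseteq> lists B"
  shows "{w \<in> lists A. h w \<in> L} \<in> C"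
  by (rule closure_properties[THEN conjunct2, THEN conjunct1, THEN spec, THEN spec, THEN spec,
      THEN mp, THEN conjunct2, THEN bspec, THEN mp, of A B]) (use assms in simp_all)

lemma Int_regular: "L \<in> C \<Longrightarrow> regular R \<Longrightarrow> L \<inter> R \<in> C"
  using closure_properties[THEN conjunct2, THEN conjunct2, THEN conjunct1] by simp

lemma Un_closed: "L \<in> C \<Longrightarrow> K \<in> C \<Longrightarrow> L \<union> K \<in> C"
  using closure_properties[THEN conjunct2, THEN conjunct2, THEN conjunct2, THEN conjunct1] by simp

lemma map_image:
  assumes "L \<in> C"
  shows "map g ` L \<in> C"
proof -
  obtain A where A: "finite A" "L \<subseteq> lists A"
    using finite_alphabet[OF assms] by blast
  show ?thesis
    by (rule hom_image[OF A(1) finite_imageI[OF A(1)] map_hom[OF order_refl] assms A(2)])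
qed

text \<open>Erasing all letters maps a nonempty language to \<open>{[]}\<close>, and the preimage of
  \<open>{[]}\<close> under the homomorphism that erases \<open>A\<close> consists of all words over
  \<open>A\<close>.\<close>

lemma lists_in_class:
  assumes "finite A"
  shows "lists A \<in> C"
proof -
  obtain L w where L: "L \<in> C" "w \<in> L" using nontrivial by blast
  obtain B where B: "finite B" "L \<subseteq> lists B" using finite_alphabet[OF L(1)] by blast
  have "(\<lambda>w. concat (map (\<lambda>_. []) w)) ` L \<in> C"
    by (rule hom_image[OF B(1) finite.emptyI concat_map_hom L(1) B(2)]) simp
  moreover have "(\<lambda>w. concat (map (\<lambda>_. []) w)) ` L = {[] :: nat list}"
    using L(2) by auto
  ultimately have eps: "{[]} \<in> C" by simp
  have "(\<lambda>w. concat (map (\<lambda>_. []) w)) \<in> monoid_hom (free_monoid A) (free_monoid ({} :: nat set))"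
    by (rule concat_map_hom) simp
  from hom_vimage[OF assms finite.emptyI this eps] show ?thesis by simp
qed

lemma finite_in_class:
  assumes "finite L"
  shows "L \<in> C"
proof -
  have "lists (\<Union>w\<in>L. set w) \<inter> L \<in> C"
    using assms by (simp add: Int_regular lists_in_class regular_finite)
  moreover have "lists (\<Union>w\<in>L. set w) \<inter> L = L" by auto
  ultimately show ?thesis by simp
qed

text \<open>The deleted suffix is guessed by an inverse homomorphism, as a word of marked (odd) letters,
  and then erased.\<close>

lemma right_quotient_word:
  assumes L: "L \<in> C"
  shows "{u. u @ v \<in> L} \<in> C"
proof -
  obtain A where A: "finite A" "L \<subseteq> lists A" using finite_alphabet[OF L] by blast
  \<comment> \<open>Even letters \<open>2 * a\<close> are copies of \<open>a\<close> to be kept, odd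
    letters \<open>2 * a + 1\<close> copies to be erased; \<open>div 2\<close> forgets the
    marking.\<close>
  define E where "E = (\<lambda>a. 2 * a) ` A"
  define B where "B = E \<union> (\<lambda>a. 2 * a + 1) ` A"
  define g where "g w = concat (map (\<lambda>a. if even a then [a div 2] else []) w)" for w :: "nat list"
  have B: "finite B" using A(1) by (simp add: B_def E_def)
  have half: "(\<lambda>a. a div 2) ` B \<subseteq> A" by (auto simp: B_def E_def)
  define K where "K = {w \<in> lists B. map (\<lambda>a. a div 2) w \<in> L} \<inter>
    lang_conc (lists E) {map (\<lambda>a. 2 * a + 1) v}"
  have "K \<in> C"
    unfolding K_def
    by (rule Int_regular[OF hom_vimage[OF B A(1) map_hom[OF half] L A(2)]])
      (use A(1) in \<open>simp add: regular.conc regular_lists regular_singleton E_def\<close>)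
  moreover have "K \<subseteq> lists B" by (auto simp: K_def)
  moreover have "g \<in> monoid_hom (free_monoid B) (free_monoid A)"
    unfolding g_def using half by (intro concat_map_hom) auto
  ultimately have "g ` K \<in> C"
    using hom_image[OF B A(1)] by blast
  moreover have "g ` K = {u. u @ v \<in> L}"
  proof -
    have g_odd: "g (x @ map (\<lambda>a. 2 * a + 1) v) = g x" for x
      by (induction v) (simp_all add: g_def)
    have g_even: "g x = map (\<lambda>a. a div 2) x" if "x \<in> lists E" for x
      using that by induction (auto simp: g_def E_def)
    have half_odd: "map (\<lambda>a. a div 2) (map (\<lambda>a. 2 * a + 1) v) = v"
      by (induction v) simp_all
    have half_even: "map (\<lambda>a. a div 2) (map (\<lambda>a. 2 * a) u) = u" for u :: "nat list"
      by (induction u) simp_all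
    have sub: "set u \<subseteq> A" "set v \<subseteq> A" if "u @ v \<in> L" for u
      using subsetD[OF A(2) that] by auto
    show ?thesis
    proof (intro subset_antisym subsetI)
      fix u assume "u \<in> g ` K"
      then obtain w where w: "w \<in> K" "u = g w" by blast
      then obtain x where x: "x \<in> lists E" "w = x @ map (\<lambda>a. 2 * a + 1) v"
        unfolding K_def lang_conc_def by blast
      have "map (\<lambda>a. a div 2) w \<in> L" using w(1) by (simp add: K_def)
      then have "map (\<lambda>a. a div 2) x @ v \<in> L"
        unfolding x(2) map_append half_odd .
      then show "u \<in> {u. u @ v \<in> L}"
        unfolding w(2) x(2) g_odd g_even[OF x(1)] by simp
    next
      fix u assume "u \<in> {u. u @ v \<in> L}"
      then have u: "u @ v \<in> L" by simp
      let ?x = "map (\<lambda>a. 2 * a) u" and ?y = "map (\<lambda>a. 2 * a + 1) v"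
      have x: "?x \<in> lists E"
        using sub(1)[OF u] by (fastforce simp: E_def)
      moreover have "?y \<in> lists B"
        using sub(2)[OF u] by (fastforce simp: B_def)
      then have "?x @ ?y \<in> lists B"
        using x by (auto simp: B_def)
      moreover have "map (\<lambda>a. a div 2) (?x @ ?y) \<in> L"
        unfolding map_append half_odd half_even by (rule u)
      ultimately have "?x @ ?y \<in> K"
        unfolding K_def lang_conc_def by blast
      moreover have "g (?x @ ?y) = u"
        unfolding g_odd g_even[OF x] half_even ..
      ultimately show "u \<in> g ` K" by (metis image_eqI)
    qed
  qed
  ultimately show ?thesis by simp
qed

end

text \<open>Puts the tables of different monoids on a common footing: both use the separators 0 and
  1, and the choice of \<open>f\<close> decides where the alphabet lands, so that two alphabets can
  be made disjoint.\<close>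

lemma (in nontrivial_full_AFL) tabled_renaming:
  assumes tab: "tabled C M" and f: "inj (f :: nat \<Rightarrow> nat)" "0 \<notin> range f" "1 \<notin> range f"
  obtains A \<pi> R where "finite A" "A \<subseteq> range f" "\<pi> \<in> monoid_hom (free_monoid A) M"
    "normal_forms M A \<pi> R" "mult_table M \<pi> 0 1 R \<in> C"
proof -
  obtain A \<pi> R s t where fin: "finite A" and \<pi>: "\<pi> \<in> monoid_hom (free_monoid A) M"
    and nf: "normal_forms M A \<pi> R"
    and st: "s \<notin> A" "t \<notin> A" "s \<noteq> t" and T: "mult_table M \<pi> s t R \<in> C"
    using tab unfolding tabled_def by (elim exE conjE)
  define \<rho> where "\<rho> w = \<pi> (map (the_inv f) w)" for w
  have \<rho>: "\<rho> (map f w) = \<pi> w" for w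
    using f(1) by (simp add: \<rho>_def comp_def the_inv_f_f)
  have RA: "R \<subseteq> lists A" using nf by (simp add: normal_forms_def)
  have "\<rho> \<in> monoid_hom (free_monoid (f ` A)) M"
    using \<pi> \<rho>[of "[]"] by (auto simp: monoid_hom_def hom_def free_monoid_def lists_image \<rho>
      simp del: map_append simp flip: map_append)
  moreover have "normal_forms M (f ` A) \<rho> (map f ` R)"
  proof -
    have "\<exists>!w. w \<in> map f ` R \<and> \<rho> w = m" if m: "m \<in> carrier M" for m
    proof -
      have "\<exists>!w. w \<in> R \<and> \<pi> w = m"
        using nf m by (simp add: normal_forms_def)
      then obtain w where w: "w \<in> R" "\<pi> w = m" and w_unique: "\<And>v. v \<in> R \<Longrightarrow> \<pi> v = m \<Longrightarrow> v = w"
        by blast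
      show ?thesis
      proof (rule ex1I[of _ "map f w"])
        show "map f w \<in> map f ` R \<and> \<rho> (map f w) = m"
          using w by (simp add: \<rho>)
      next
        fix x assume "x \<in> map f ` R \<and> \<rho> x = m"
        then obtain v where "v \<in> R" "x = map f v" "\<pi> v = m"
          by (auto simp: \<rho>)
        then show "x = map f w" using w_unique by blast
      qed
    qed
    moreover have "map f ` R \<subseteq> lists (f ` A)"
      using RA by (auto simp: lists_image)
    ultimately show ?thesis
      using nf by (simp add: normal_forms_def regular_map)
  qed
  moreover have "mult_table M \<rho> 0 1 (map f ` R) \<in> C"
  proof -
    \<comment> \<open>On \<open>A\<close> this is \<open>f\<close>, and it sends the old separators
      to the new ones. As \<open>s\<close> and \<open>t\<close> are distinct and lie outside
      \<open>A\<close>, the new table is a letterwise image of the old one.\<close>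
    define g where "g = f(s := 0, t := 1)"
    have g: "map g u = map f u" if "u \<in> R" for u
      using RA st that by (auto simp: g_def)
    have g_word: "map f u @ [0] @ map f v @ [1] @ rev (map f w) = map g (u @ [s] @ v @ [t] @ rev w)"
      if "u \<in> R" "v \<in> R" "w \<in> R" for u v w
      using g that st by (simp add: g_def rev_map)
    have "mult_table M \<rho> 0 1 (map f ` R) = map g ` mult_table M \<pi> s t R"
    proof (intro subset_antisym subsetI)
      fix x assume "x \<in> mult_table M \<rho> 0 1 (map f ` R)"
      then obtain u v w where "u \<in> R" "v \<in> R" "w \<in> R" "\<pi> u \<otimes>\<^bsub>M\<^esub> \<pi> v = \<pi> w"
        "x = map f u @ [0] @ map f v @ [1] @ rev (map f w)"
        unfolding mult_table_def by (auto simp: \<rho> simp del: append.simps)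
      then show "x \<in> map g ` mult_table M \<pi> s t R"
        unfolding mult_table_def using g_word by blast
    next
      fix x assume "x \<in> map g ` mult_table M \<pi> s t R"
      then obtain u v w where uvw: "u \<in> R" "v \<in> R" "w \<in> R" "\<pi> u \<otimes>\<^bsub>M\<^esub> \<pi> v = \<pi> w"
        "x = map g (u @ [s] @ v @ [t] @ rev w)"
        unfolding mult_table_def by blast
      have "\<rho> (map f u) \<otimes>\<^bsub>M\<^esub> \<rho> (map f v) = \<rho> (map f w)"
        unfolding \<rho> by (rule uvw(4))
      moreover have "x = map f u @ [0] @ map f v @ [1] @ rev (map f w)"
        unfolding uvw(5) by (rule g_word[OF uvw(1-3), symmetric])
      ultimately show "x \<in> mult_table M \<rho> 0 1 (map f ` R)"
        unfolding mult_table_def using uvw(1-3) by blast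
    qed
    then show ?thesis using map_image[OF T] by simp
  qed
  ultimately show ?thesis
    using that[of "f ` A" \<rho> "map f ` R"] fin by blast
qed


section \<open>Alternating normal forms in the free product\<close>

locale two_monoids = M: monoid M + N: monoid N
  for M :: "('a, 'm) monoid_scheme" and N :: "('b, 'n) monoid_scheme"
begin

abbreviation letters :: "('a + 'b) set" where
  "letters \<equiv> carrier M <+> carrier N"

abbreviation cls :: "('a + 'b) list \<Rightarrow> ('a + 'b) list set" where
  "cls \<equiv> pres_class letters (free_product_rels M N)"

definition unit_letter :: "'a + 'b \<Rightarrow> bool" where
  "unit_letter x \<longleftrightarrow> x = Inl \<one>\<^bsub>M\<^esub> \<or> x = Inr \<one>\<^bsub>N\<^esub>"

text \<open>Only meaningful if both letters come from the same factor.\<close>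

fun merge :: "'a + 'b \<Rightarrow> 'a + 'b \<Rightarrow> 'a + 'b" where
  "merge (Inl x) (Inl y) = Inl (x \<otimes>\<^bsub>M\<^esub> y)"
| "merge (Inr x) (Inr y) = Inr (x \<otimes>\<^bsub>N\<^esub> y)"
| "merge x y = x"

definition alternating :: "('a + 'b) list \<Rightarrow> bool" where
  "alternating l \<longleftrightarrow> l \<in> lists letters \<and> (\<forall>x\<in>set l. \<not> unit_letter x) \<and>
     successively (\<lambda>x y. isl x \<noteq> isl y) l"

definition cons :: "'a + 'b \<Rightarrow> ('a + 'b) list \<Rightarrow> ('a + 'b) list" where
  "cons x l = (if unit_letter x then l else x # l)"

fun act :: "'a + 'b \<Rightarrow> ('a + 'b) list \<Rightarrow> ('a + 'b) list" where
  "act x [] = cons x []"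
| "act x (y # l) = (if isl x = isl y then cons (merge x y) l else cons x (y # l))"

definition reduce :: "('a + 'b) list \<Rightarrow> ('a + 'b) list" where
  "reduce w = foldr act w []"

lemma alternating_Nil [simp]: "alternating []"
  by (simp add: alternating_def)

lemma alternating_Cons:
  "alternating (x # l) \<longleftrightarrow> x \<in> letters \<and> \<not> unit_letter x \<and> alternating l \<and>
     (l = [] \<or> isl x \<noteq> isl (hd l))"
  by (auto simp: alternating_def successively_Cons)

lemma alternating_letters: "alternating l \<Longrightarrow> l \<in> lists letters"
  by (simp add: alternating_def)

lemma merge_closed: "x \<in> letters \<Longrightarrow> y \<in> letters \<Longrightarrow> merge x y \<in> letters"
  by auto

lemma isl_merge [simp]: "isl (merge x y) = isl x"
  by (cases x; cases y) auto

lemma act_alternating: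
  assumes "x \<in> letters" "alternating l"
  shows "alternating (act x l)"
proof (cases l)
  case Nil
  then show ?thesis using assms by (simp add: cons_def alternating_Cons)
next
  case (Cons y k)
  then show ?thesis
    using assms merge_closed[of x y] by (auto simp: cons_def alternating_Cons)
qed

lemma foldr_act_alternating:
  assumes "w \<in> lists letters" "alternating l"
  shows "alternating (foldr act w l)"
  using assms(1) by induction (auto simp: act_alternating assms(2))

text \<open>Even if the head of \<open>l\<close> lies in the factor of the unit \<open>x\<close>,
  merging gives back that head, and \<open>cons\<close> keeps it because alternating words contain
  no units.\<close>

lemma act_unit:
  assumes "unit_letter x" "alternating l"
  shows "act x l = l"
proof (cases l)
  case (Cons y k)
  with assms show ?thesis
    by (auto simp: unit_letter_def alternating_Cons cons_def isl_def)
qed (use assms in \<open>simp add: cons_def\<close>)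

lemma merge_assoc:
  assumes "x \<in> letters" "y \<in> letters" "z \<in> letters" "isl x = isl y" "isl y = isl z"
  shows "merge (merge x y) z = merge x (merge y z)"
  using assms by (auto simp: M.m_assoc N.m_assoc)

lemma merge_unit_right:
  assumes "x \<in> letters" "unit_letter y" "isl x = isl y"
  shows "merge x y = x"
  using assms by (auto simp: unit_letter_def)

text \<open>This makes each factor act as a monoid. If \<open>l\<close> starts in the factor of
  \<open>x\<close> and \<open>y\<close>, the matter is reduced to associativity; otherwise a letter
  of that factor is only prepended, or dropped if it is a unit.\<close>

lemma act_act:
  assumes x: "x \<in> letters" and y: "y \<in> letters" and xy: "isl x = isl y" and l: "alternating l"
  shows "act x (act y l) = act (merge x y) l"
proof (cases "l \<noteq> [] \<and> isl y = isl (hd l)")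
  case True
  then obtain z k where lz: "l = z # k" "isl y = isl z" by (cases l) auto
  then have z: "z \<in> letters" "k = [] \<or> isl z \<noteq> isl (hd k)"
    using l by (auto simp: alternating_Cons)
  have assoc: "merge (merge x y) z = merge x (merge y z)"
    using x y z(1) xy lz(2) by (rule merge_assoc)
  show ?thesis
  \<comment> \<open>If \<open>y\<close> cancels the head \<open>z\<close>, the rest \<open>k\<close>
    is empty or starts in the other factor, so \<open>x\<close> is only prepended to it; and
    \<open>x\<close> is also the product of all three letters.\<close>
  proof (cases "unit_letter (merge y z)")
    case True
    then have "merge x (merge y z) = x"
      using merge_unit_right[OF x] xy lz(2) by simp
    moreover have "act x k = cons x k"
      using z(2) xy lz(2) by (cases k) auto
    ultimately show ?thesis
      using True lz xy by (simp add: cons_def assoc)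
  qed (use lz xy in \<open>simp add: cons_def assoc\<close>)
next
  case False
  then have *: "act w l = cons w l" if "isl w = isl y" for w
    using that by (cases l) auto
  show ?thesis
  proof (cases "unit_letter y")
    case True
    then show ?thesis
      using xy merge_unit_right[OF x True xy] by (simp add: * cons_def)
  qed (use xy in \<open>simp add: * cons_def\<close>)
qed

lemma reduce_alternating: "w \<in> lists letters \<Longrightarrow> alternating (reduce w)"
  by (simp add: reduce_def foldr_act_alternating)

lemma reduce_id: "alternating l \<Longrightarrow> reduce l = l"
proof (induction l)
  case (Cons x l)
  then have "reduce (x # l) = act x l"
    by (simp add: reduce_def alternating_Cons)
  also have "\<dots> = x # l"
    using Cons.prems by (cases l) (auto simp: alternating_Cons cons_def)
  finally show ?case .
qed (simp add: reduce_def)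

lemma reduce_merge:
  assumes "x \<in> letters" "y \<in> letters" "isl x = isl y" "q \<in> lists letters"
  shows "reduce (p @ [x, y] @ q) = reduce (p @ [merge x y] @ q)"
  using act_act[OF assms(1-3) foldr_act_alternating[OF assms(4) alternating_Nil]]
  by (simp add: reduce_def)

lemma reduce_unit:
  assumes "unit_letter x" "q \<in> lists letters"
  shows "reduce (p @ [x] @ q) = reduce (p @ q)"
  using act_unit[OF assms(1) foldr_act_alternating[OF assms(2) alternating_Nil]]
  by (simp add: reduce_def)

text \<open>The defining relations are of two kinds, multiplication within a factor and deletion of
  a unit, and each kind respects the action on alternating words.\<close>

lemma reduce_rewrite_step:
  assumes "rewrite_step letters (free_product_rels M N) u v"
  shows "reduce u = reduce v"
proof -
  obtain p q l r where q: "q \<in> lists letters" and lr: "(l, r) \<in> free_product_rels M N"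
    and uv: "u = p @ l @ q" "v = p @ r @ q"
    using assms unfolding rewrite_step_def by blast
  consider x y where "l = [x, y]" "r = [merge x y]" "x \<in> letters" "y \<in> letters" "isl x = isl y"
    | x where "l = [x]" "r = []" "unit_letter x"
    using lr by (fastforce simp: free_product_rels_def unit_letter_def)
  then show ?thesis
  proof cases
    case 1
    then show ?thesis using q reduce_merge[of x y q p] by (simp add: uv)
  next
    case 2
    then show ?thesis using q reduce_unit[of x q p] by (simp add: uv)
  qed
qed

lemma reduce_equivclp:
  assumes "equivclp (rewrite_step letters (free_product_rels M N)) u v"
  shows "reduce u = reduce v"
  using assms by (induction rule: equivclp_induct) (auto dest: reduce_rewrite_step)

lemma cls_eq_rel:
  assumes "(l, r) \<in> free_product_rels M N" "l \<in> lists letters" "r \<in> lists letters"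
    "p \<in> lists letters" "q \<in> lists letters"
  shows "cls (p @ l @ q) = cls (p @ r @ q)"
  by (intro pres_class_eqI r_into_equivclp) (use assms in \<open>auto simp: rewrite_step_def\<close>)

lemma cls_merge:
  assumes "x \<in> letters" "y \<in> letters" "isl x = isl y" "p \<in> lists letters" "q \<in> lists letters"
  shows "cls (p @ [x, y] @ q) = cls (p @ [merge x y] @ q)"
  by (rule cls_eq_rel) (use assms in \<open>auto simp: free_product_rels_def\<close>)

lemma cls_unit:
  assumes "unit_letter x" "p \<in> lists letters" "q \<in> lists letters"
  shows "cls (p @ [x] @ q) = cls (p @ q)"
  using cls_eq_rel[of "[x]" "[]" p q] assms by (auto simp: free_product_rels_def unit_letter_def)

text \<open>Computing the action uses nothing but defining relations, so it stays in the class of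
  the word with \<open>x\<close> put in front.\<close>

lemma cls_act:
  assumes x: "x \<in> letters" and l: "l \<in> lists letters"
  shows "cls (act x l) = cls (x # l)"
proof -
  have cons: "cls (cons w k) = cls (w # k)" if "w \<in> letters" "k \<in> lists letters" for w k
    using that cls_unit[of w "[]" k] by (simp add: cons_def)
  show ?thesis
  proof (cases l)
    case Nil
    then show ?thesis using cons x by simp
  next
    case (Cons y k)
    then show ?thesis
      using cons x l merge_closed[of x y] cls_merge[of x y "[]" k] by auto
  qed
qed

lemma cls_Cons:
  assumes "x \<in> letters" "l \<in> lists letters"
  shows "cls (x # l) = cls [x] \<otimes>\<^bsub>free_product M N\<^esub> cls l"
  using pres_class_mult[of "[x]" letters l] assms by (simp add: free_product_def)

lemma cls_reduce:
  assumes "w \<in> lists letters"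
  shows "cls (reduce w) = cls w"
  using assms
proof induction
  case (Cons x w)
  have "reduce w \<in> lists letters"
    using Cons.hyps reduce_alternating alternating_letters by blast
  then show ?case
    using Cons cls_act[of x "reduce w"] cls_Cons[of x "reduce w"] cls_Cons[of x w]
    by (simp add: reduce_def)
qed (simp add: reduce_def)

text \<open>\<open>reduce\<close> is a complete invariant: it is constant on classes, and a word
  lies in the same class as its reduction. With \<open>reduce_id\<close>, distinct alternating words
  represent distinct elements.\<close>

lemma cls_eq_iff:
  assumes "u \<in> lists letters" "v \<in> lists letters"
  shows "cls u = cls v \<longleftrightarrow> reduce u = reduce v"
proof
  assume "cls u = cls v"
  then have "v \<in> cls u" using pres_class_self[OF assms(2)] by simp
  then show "reduce u = reduce v" by (simp add: pres_class_def reduce_equivclp)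
next
  assume "reduce u = reduce v"
  then show "cls u = cls v" using cls_reduce assms by metis
qed

end

section \<open>Encoding normal forms as words\<close>

text \<open>Disjoint alphabets let each letter reveal its factor; 0, 1 and 2 are reserved as control
  symbols of the rewriting system.\<close>

locale two_tables = two_monoids M N
  for M :: "('a, 'm) monoid_scheme" and N :: "('b, 'n) monoid_scheme" +
  fixes A B :: "nat set" and \<alpha> :: "nat list \<Rightarrow> 'a" and \<beta> :: "nat list \<Rightarrow> 'b"
    and R S :: "nat list set"
  assumes finite_A: "finite A" and finite_B: "finite B" and disjoint: "A \<inter> B = {}"
    and separators: "{0, 1, 2} \<inter> (A \<union> B) = {}"
    and \<alpha>: "\<alpha> \<in> monoid_hom (free_monoid A) M" and \<beta>: "\<beta> \<in> monoid_hom (free_monoid B) N"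
    and R: "normal_forms M A \<alpha> R" and S: "normal_forms N B \<beta> S"
begin

abbreviation P where "P \<equiv> free_product M N"

sublocale P: monoid P by (rule monoid_free_product)

definition letter :: "nat \<Rightarrow> 'a + 'b" where
  "letter a = (if a \<in> A then Inl (\<alpha> [a]) else Inr (\<beta> [a]))"

definition eval :: "nat list \<Rightarrow> ('a + 'b) list set" where
  "eval w = cls (map letter w)"

definition form :: "'a + 'b \<Rightarrow> nat list" where
  "form x = (case x of Inl m \<Rightarrow> (THE w. w \<in> R \<and> \<alpha> w = m) | Inr n \<Rightarrow> (THE w. w \<in> S \<and> \<beta> w = n))"

definition encode :: "('a + 'b) list \<Rightarrow> nat list" where
  "encode l = concat (map form l)"

definition forms :: "nat list set" where
  "forms = encode ` {l. alternating l}"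

lemma \<alpha>_simps: "u \<in> lists A \<Longrightarrow> \<alpha> u \<in> carrier M" "\<alpha> [] = \<one>\<^bsub>M\<^esub>"
  "u \<in> lists A \<Longrightarrow> v \<in> lists A \<Longrightarrow> \<alpha> (u @ v) = \<alpha> u \<otimes>\<^bsub>M\<^esub> \<alpha> v"
  using \<alpha> by (auto simp: monoid_hom_def hom_def free_monoid_def Pi_def)

lemma \<beta>_simps: "u \<in> lists B \<Longrightarrow> \<beta> u \<in> carrier N" "\<beta> [] = \<one>\<^bsub>N\<^esub>"
  "u \<in> lists B \<Longrightarrow> v \<in> lists B \<Longrightarrow> \<beta> (u @ v) = \<beta> u \<otimes>\<^bsub>N\<^esub> \<beta> v"
  using \<beta> by (auto simp: monoid_hom_def hom_def free_monoid_def Pi_def)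

lemma letter_closed: "a \<in> A \<union> B \<Longrightarrow> letter a \<in> letters"
  using \<alpha>_simps(1)[of "[a]"] \<beta>_simps(1)[of "[a]"] by (auto simp: letter_def)

lemma map_letter_closed: "w \<in> lists (A \<union> B) \<Longrightarrow> map letter w \<in> lists letters"
  by (induction rule: lists.induct) (simp_all add: letter_closed)

lemma eval_append:
  "u \<in> lists (A \<union> B) \<Longrightarrow> v \<in> lists (A \<union> B) \<Longrightarrow> eval (u @ v) = eval u \<otimes>\<^bsub>P\<^esub> eval v"
  using pres_class_mult[OF map_letter_closed map_letter_closed]
  by (simp add: eval_def free_product_def)

lemma eval_Nil: "eval [] = \<one>\<^bsub>P\<^esub>"
  by (simp add: eval_def free_product_def presented_monoid_def)

lemma carrier_P: "carrier P = cls ` lists letters"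
  by (simp add: free_product_def presented_monoid_def)

lemma eval_closed: "w \<in> lists (A \<union> B) \<Longrightarrow> eval w \<in> carrier P"
  unfolding carrier_P eval_def by (intro imageI map_letter_closed)

lemma eval_hom: "eval \<in> monoid_hom (free_monoid (A \<union> B)) P"
  using eval_append eval_closed eval_Nil
  by (auto simp: monoid_hom_def hom_def free_monoid_def)

text \<open>All letters come from the same factor, so the word collapses letter by letter into a
  single syllable; the empty word is matched by the relation deleting the unit.\<close>

lemma eval_left:
  assumes "w \<in> lists A" shows "eval w = cls [Inl (\<alpha> w)]"
  using assms
proof induction
  case Nil
  then show ?case
    using cls_unit[of "Inl \<one>\<^bsub>M\<^esub>" "[]" "[]"] by (simp add: eval_def \<alpha>_simps(2) unit_letter_def)
next
  case (Cons a w)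
  have "\<alpha> (a # w) = \<alpha> [a] \<otimes>\<^bsub>M\<^esub> \<alpha> w"
    using \<alpha>_simps(3)[of "[a]" w] Cons.hyps by simp
  moreover have "eval (a # w) = eval [a] \<otimes>\<^bsub>P\<^esub> eval w"
    using eval_append[of "[a]" w] Cons.hyps by auto
  moreover have "eval [a] = cls [Inl (\<alpha> [a])]"
    using Cons.hyps by (simp add: eval_def letter_def)
  moreover have "\<alpha> [a] \<in> carrier M" "\<alpha> w \<in> carrier M"
    using \<alpha>_simps(1) Cons.hyps by auto
  ultimately show ?case
    using Cons.IH cls_merge[of "Inl (\<alpha> [a])" "Inl (\<alpha> w)" "[]" "[]"]
      cls_Cons[of "Inl (\<alpha> [a])" "[Inl (\<alpha> w)]"]
    by (simp add: InlI)
qed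

lemma eval_right:
  assumes "w \<in> lists B" shows "eval w = cls [Inr (\<beta> w)]"
  using assms
proof induction
  case Nil
  then show ?case
    using cls_unit[of "Inr \<one>\<^bsub>N\<^esub>" "[]" "[]"] by (simp add: eval_def \<beta>_simps(2) unit_letter_def)
next
  case (Cons a w)
  have "\<beta> (a # w) = \<beta> [a] \<otimes>\<^bsub>N\<^esub> \<beta> w"
    using \<beta>_simps(3)[of "[a]" w] Cons.hyps by simp
  moreover have "eval (a # w) = eval [a] \<otimes>\<^bsub>P\<^esub> eval w"
    using eval_append[of "[a]" w] Cons.hyps by auto
  moreover have "eval [a] = cls [Inr (\<beta> [a])]"
    using Cons.hyps disjoint by (auto simp: eval_def letter_def)
  moreover have "\<beta> [a] \<in> carrier N" "\<beta> w \<in> carrier N"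
    using \<beta>_simps(1) Cons.hyps by auto
  ultimately show ?case
    using Cons.IH cls_merge[of "Inr (\<beta> [a])" "Inr (\<beta> w)" "[]" "[]"]
      cls_Cons[of "Inr (\<beta> [a])" "[Inr (\<beta> w)]"]
    by (simp add: InrI)
qed

lemma R_lists: "R \<subseteq> lists A" and S_lists: "S \<subseteq> lists B"
  using R S by (simp_all add: normal_forms_def)

lemma form_Inl:
  assumes "m \<in> carrier M"
  shows "form (Inl m) \<in> R" "\<alpha> (form (Inl m)) = m"
proof -
  have "\<exists>!w. w \<in> R \<and> \<alpha> w = m"
    using R assms by (simp add: normal_forms_def)
  from theI'[OF this] show "form (Inl m) \<in> R" "\<alpha> (form (Inl m)) = m"
    by (simp_all add: form_def)
qed

lemma form_Inr:
  assumes "n \<in> carrier N"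
  shows "form (Inr n) \<in> S" "\<beta> (form (Inr n)) = n"
proof -
  have "\<exists>!w. w \<in> S \<and> \<beta> w = n"
    using S assms by (simp add: normal_forms_def)
  from theI'[OF this] show "form (Inr n) \<in> S" "\<beta> (form (Inr n)) = n"
    by (simp_all add: form_def)
qed

lemma form_\<alpha>:
  assumes "w \<in> R" shows "form (Inl (\<alpha> w)) = w"
proof -
  have m: "\<alpha> w \<in> carrier M" using assms R_lists \<alpha>_simps(1) by blast
  then have "\<exists>!v. v \<in> R \<and> \<alpha> v = \<alpha> w"
    using R by (simp add: normal_forms_def)
  with form_Inl[OF m] assms show ?thesis by blast
qed

lemma form_\<beta>:
  assumes "w \<in> S" shows "form (Inr (\<beta> w)) = w"
proof -
  have n: "\<beta> w \<in> carrier N" using assms S_lists \<beta>_simps(1) by blast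
  then have "\<exists>!v. v \<in> S \<and> \<beta> v = \<beta> w"
    using S by (simp add: normal_forms_def)
  with form_Inr[OF n] assms show ?thesis by blast
qed

lemma form_lists:
  assumes "x \<in> letters" shows "form x \<in> lists (A \<union> B)"
proof -
  consider m where "x = Inl m" "m \<in> carrier M" | n where "x = Inr n" "n \<in> carrier N"
    using assms by blast
  then have "form x \<in> lists A \<union> lists B"
    using form_Inl(1) form_Inr(1) R_lists S_lists by cases blast+
  then show ?thesis by auto
qed

lemma eval_form:
  assumes "x \<in> letters" shows "eval (form x) = cls [x]"
proof -
  consider m where "x = Inl m" "m \<in> carrier M" | n where "x = Inr n" "n \<in> carrier N"
    using assms by blast
  then show ?thesis
  proof cases
    case 1
    then show ?thesis
      using form_Inl[of m] eval_left[OF subsetD[OF R_lists], of "form x"] by simp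
  next
    case 2
    then show ?thesis
      using form_Inr[of n] eval_right[OF subsetD[OF S_lists], of "form x"] by simp
  qed
qed

lemma encode_simps [simp]:
  "encode [] = []" "encode (x # l) = form x @ encode l" "encode (l @ k) = encode l @ encode k"
  by (simp_all add: encode_def)

lemma encode_lists: "l \<in> lists letters \<Longrightarrow> encode l \<in> lists (A \<union> B)"
  by (induction rule: lists.induct) (simp_all add: form_lists)

lemma eval_encode: "l \<in> lists letters \<Longrightarrow> eval (encode l) = cls l"
proof (induction rule: lists.induct)
  case Nil
  then show ?case by (simp add: eval_def)
next
  case (Cons x l)
  then show ?case
    using eval_append[OF form_lists encode_lists, of x l] eval_form[of x] cls_Cons[of x l] by simp
qed

lemma forms_lists: "forms \<subseteq> lists (A \<union> B)"
  unfolding forms_def using encode_lists alternating_letters by blast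

text \<open>Uniqueness does not require decoding a word into syllables: two encodings with the same
  value come from alternating words of the same class, and these coincide.\<close>

lemma forms_representative:
  assumes "X \<in> carrier P"
  shows "\<exists>!w. w \<in> forms \<and> eval w = X"
proof -
  obtain u where u: "u \<in> lists letters" "X = cls u"
    using assms unfolding carrier_P by blast
  note alt = reduce_alternating[OF u(1)]
  have eval: "eval (encode (reduce u)) = X"
    using eval_encode[OF alternating_letters[OF alt]] cls_reduce[OF u(1)] u(2) by simp
  have unique: "w = encode (reduce u)" if w: "w \<in> forms" "eval w = X" for w
  proof -
    obtain l where l: "alternating l" "w = encode l"
      using w(1) unfolding forms_def by blast
    then have "cls l = cls u"
      using w(2) u(2) eval_encode[OF alternating_letters[OF l(1)]] by simp
    then show ?thesis
      using cls_eq_iff[OF alternating_letters[OF l(1)] u(1)] l reduce_id by simp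
  qed
  have "encode (reduce u) \<in> forms"
    using alt by (simp add: forms_def)
  with eval show ?thesis
    by (intro ex1I[of _ "encode (reduce u)"] conjI) (assumption | erule conjE, rule unique)+
qed

section \<open>Regularity of the set of normal forms\<close>

definition "left_forms = R - {form (Inl \<one>\<^bsub>M\<^esub>)}"
definition "right_forms = S - {form (Inr \<one>\<^bsub>N\<^esub>)}"

lemma left_forms_eq: "left_forms = form ` {x \<in> letters. \<not> unit_letter x \<and> isl x}" (is "_ = ?K")
proof (intro subset_antisym subsetI)
  fix w assume w: "w \<in> left_forms"
  then have "w \<in> R" "w \<noteq> form (Inl \<one>\<^bsub>M\<^esub>)" by (simp_all add: left_forms_def)
  then have "form (Inl (\<alpha> w)) = w" "\<alpha> w \<noteq> \<one>\<^bsub>M\<^esub>" and "\<alpha> w \<in> carrier M"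
    using form_\<alpha>[of w] \<alpha>_simps(1)[OF subsetD[OF R_lists]] by auto
  then show "w \<in> ?K"
    by (intro image_eqI[of _ _ "Inl (\<alpha> w)"]) (simp_all add: unit_letter_def InlI)
next
  fix w assume "w \<in> ?K"
  then obtain m where m: "m \<in> carrier M" "m \<noteq> \<one>\<^bsub>M\<^esub>" "w = form (Inl m)"
    by (auto simp: unit_letter_def)
  then show "w \<in> left_forms"
    using form_Inl[OF m(1)] form_Inl[OF M.one_closed] by (auto simp: left_forms_def)
qed

lemma right_forms_eq: "right_forms = form ` {x \<in> letters. \<not> unit_letter x \<and> \<not> isl x}" (is "_ = ?K")
proof (intro subset_antisym subsetI)
  fix w assume w: "w \<in> right_forms"
  then have "w \<in> S" "w \<noteq> form (Inr \<one>\<^bsub>N\<^esub>)" by (simp_all add: right_forms_def)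
  then have "form (Inr (\<beta> w)) = w" "\<beta> w \<noteq> \<one>\<^bsub>N\<^esub>" and "\<beta> w \<in> carrier N"
    using form_\<beta>[of w] \<beta>_simps(1)[OF subsetD[OF S_lists]] by auto
  then show "w \<in> ?K"
    by (intro image_eqI[of _ _ "Inr (\<beta> w)"]) (simp_all add: unit_letter_def InrI)
next
  fix w assume "w \<in> ?K"
  then obtain n where n: "n \<in> carrier N" "n \<noteq> \<one>\<^bsub>N\<^esub>" "w = form (Inr n)"
    by (auto simp: unit_letter_def)
  then show "w \<in> right_forms"
    using form_Inr[OF n(1)] form_Inr[OF N.one_closed] by (auto simp: right_forms_def)
qed

lemma regular_forms: "regular forms"
proof -
  \<comment> \<open>\<open>E\<close> and \<open>F\<close> are to consist of the encodings of
    alternating words that are empty or start in the left, respectively the right factor.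
    \<open>X\<close> collects left-right pairs, and \<open>E\<close> allows one unpaired left
    syllable at the end.\<close>
  define X where "X = lang_star (lang_conc left_forms right_forms)"
  define E where "E = lang_conc X ({[]} \<union> left_forms)"
  define F where "F = {[]} \<union> lang_conc right_forms E"
  \<comment> \<open>The counterpart for \<open>E\<close> of the definition of \<open>F\<close>: a
    left syllable in front of a word of \<open>F\<close> is either the unpaired last syllable or
    completes a new first pair.\<close>
  have E_left: "u @ v \<in> E" if uv: "u \<in> left_forms" "v \<in> F" for u v
  proof (cases "v = []")
    case True
    have "[] @ u \<in> E"
      unfolding E_def X_def by (rule append_in_lang_conc) (use uv in simp_all)
    with True show ?thesis by simp
  next
    case False
    with uv(2) obtain x s y where x: "x \<in> right_forms" and s: "s \<in> X"
      and y: "y \<in> {[]} \<union> left_forms" and v: "v = x @ s @ y"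
      unfolding F_def E_def lang_conc_def by blast
    have "(u @ x) @ s \<in> X"
      unfolding X_def
      by (rule append_in_lang_star[OF append_in_lang_conc[OF uv(1) x] s[unfolded X_def]])
    from append_in_lang_conc[OF this y] show ?thesis
      by (simp add: E_def v)
  qed
  have "(l = [] \<or> isl (hd l) \<longrightarrow> encode l \<in> E) \<and> (l = [] \<or> \<not> isl (hd l) \<longrightarrow> encode l \<in> F)"
    if "alternating l" for l
    using that
  proof (induction l)
    case Nil
    have "[] @ [] \<in> E"
      unfolding E_def X_def by (rule append_in_lang_conc) simp_all
    then show ?case by (simp add: F_def)
  next
    case (Cons x l)
    then have x: "x \<in> letters" "\<not> unit_letter x" and l: "l = [] \<or> isl x \<noteq> isl (hd l)"
      and alt: "alternating l"
      by (simp_all add: alternating_Cons)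
    note IH = Cons.IH[OF alt]
    show ?case
    proof (cases "isl x")
      case True
      then have "form x \<in> left_forms" using x unfolding left_forms_eq by blast
      moreover have "encode l \<in> F" using IH True l by blast
      ultimately show ?thesis using True E_left by simp
    next
      case False
      then have "form x \<in> right_forms" using x unfolding right_forms_eq by blast
      moreover have "encode l \<in> E" using IH False l by blast
      ultimately show ?thesis
        using False append_in_lang_conc[of "form x" right_forms "encode l" E] by (simp add: F_def)
    qed
  qed
  then have sub: "forms \<subseteq> E \<union> F"
    unfolding forms_def by blast
  have E_sub: "\<exists>l. w = encode l \<and> alternating l \<and> (l = [] \<or> isl (hd l))" if w: "w \<in> E" for w
  proof -
    obtain s y where s: "s \<in> X" and y: "y \<in> {[]} \<union> left_forms" and sy: "w = s @ y"
      using w unfolding E_def lang_conc_def by blast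
    \<comment> \<open>\<open>y\<close> stays fixed, so the induction adds pairs in front of the
      possible unpaired last syllable.\<close>
    from s have "\<exists>l. s @ y = encode l \<and> alternating l \<and> (l = [] \<or> isl (hd l))"
      unfolding X_def
    proof (induction rule: lang_star_induct)
      case Nil
      show ?case
      proof (cases "y = []")
        case True
        then show ?thesis by (intro exI[of _ "[]"]) simp
      next
        case False
        then obtain x where "x \<in> letters" "\<not> unit_letter x" "isl x" "y = form x"
          using y unfolding left_forms_eq by blast
        then show ?thesis by (intro exI[of _ "[x]"]) (simp add: alternating_Cons)
      qed
    next
      case (append u v)
      obtain l where l: "v @ y = encode l" "alternating l" "l = [] \<or> isl (hd l)"
        using append.IH by blast
      obtain x z where "x \<in> letters" "\<not> unit_letter x" "isl x"
        "z \<in> letters" "\<not> unit_letter z" "\<not> isl z" "u = form x @ form z"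
        using append.hyps(1) unfolding lang_conc_def left_forms_eq right_forms_eq by blast
      with l show ?case
        by (intro exI[of _ "x # z # l"]) (auto simp: alternating_Cons)
    qed
    then show ?thesis by (simp add: sy)
  qed
  have F_sub: "w \<in> forms" if "w \<in> F" for w
  proof (cases "w = []")
    case True
    then show ?thesis
      unfolding forms_def by (intro image_eqI[of _ _ "[]"]) simp_all
  next
    case False
    then obtain x v where x: "x \<in> letters" "\<not> unit_letter x" "\<not> isl x"
      and v: "v \<in> E" "w = form x @ v"
      using \<open>w \<in> F\<close> unfolding F_def lang_conc_def right_forms_eq by blast
    obtain l where "v = encode l" "alternating l" "l = [] \<or> isl (hd l)"
      using E_sub[OF v(1)] by blast
    with x v(2) show ?thesis
      unfolding forms_def by (intro image_eqI[of _ _ "x # l"]) (auto simp: alternating_Cons)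
  qed
  have eq: "forms = E \<union> F"
    using sub E_sub F_sub unfolding forms_def by blast
  have "regular left_forms" "regular right_forms"
    unfolding left_forms_def right_forms_def using R S finite_A finite_B
    by (simp_all add: normal_forms_def regular_remove_word)
  then show ?thesis
    unfolding eq X_def E_def F_def by (intro regular.intros)
qed

lemma normal_forms_free_product: "normal_forms P (A \<union> B) eval forms"
  unfolding normal_forms_def using forms_lists regular_forms forms_representative by blast

lemma eval_surj: "eval ` lists (A \<union> B) = carrier P"
proof (intro subset_antisym subsetI)
  fix X assume "X \<in> carrier P"
  then obtain w where "w \<in> forms" "X = eval w"
    using forms_representative by metis
  then show "X \<in> eval ` lists (A \<union> B)"
    using forms_lists by blast
qed (use eval_closed in blast)

end

section \<open>The multiplication table as a set of ancestors\<close>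

context two_tables
begin

declare One_nat_def [simp del]

text \<open>The letters 0 and 1 are the separators; 2 replaces both of them once the syllables of the two
  factors have been multiplied, and the rest of a word with a 2 only has to be a palindrome.\<close>

abbreviation symbols :: "nat set" where
  "symbols \<equiv> A \<union> B \<union> {0, 1, 2}"

text \<open>\<open>cancel\<close> and \<open>combine\<close> range over all letters of a factor,
  units included. In this way the left-hand sides of \<open>combine\<close> are exactly the two
  given tables, and those of \<open>cancel\<close> are quotients of them. Soundness is unaffected,
  as only values are compared.\<close>

inductive_set rules :: "(nat list \<times> nat list) set" where
  cancel: "x \<in> letters \<Longrightarrow> y \<in> letters \<Longrightarrow> isl x = isl y \<Longrightarrow> unit_letter (merge x y) \<Longrightarrow>
    (form x @ [0] @ form y, [0]) \<in> rules"
| copy: "a \<in> A \<union> B \<Longrightarrow> ([a, 1, a], [1]) \<in> rules"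
| combine: "x \<in> letters \<Longrightarrow> y \<in> letters \<Longrightarrow> isl x = isl y \<Longrightarrow>
    (form x @ [0] @ form y @ [1] @ rev (form (merge x y)), [2]) \<in> rules"
| meet: "([0, 1], [2]) \<in> rules"
| peel: "a \<in> A \<union> B \<Longrightarrow> ([a, 2, a], [2]) \<in> rules"

section \<open>Soundness: an invariant shared by all ancestors of the word
  \<open>[2]\<close>\<close>

definition balanced :: "nat list \<Rightarrow> bool" where
  "balanced z \<longleftrightarrow>
     (\<exists>p\<in>lists (A \<union> B). \<exists>q\<in>lists (A \<union> B). z = p @ [2] @ q \<and> eval p = eval (rev q)) \<or>
     (\<exists>u\<in>lists (A \<union> B). \<exists>v\<in>lists (A \<union> B). \<exists>w\<in>lists (A \<union> B).
        z = u @ [0] @ v @ [1] @ w \<and> eval u \<otimes>\<^bsub>P\<^esub> eval v = eval (rev w))"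

lemma separators_notin:
  assumes "w \<in> lists (A \<union> B)"
  shows "0 \<notin> set w" "1 \<notin> set w" "2 \<notin> set w"
  using assms separators by auto

lemma rev_in_lists [simp]: "rev w \<in> lists X \<longleftrightarrow> w \<in> lists X"
  by (simp add: in_lists_conv_set)

lemma rules_symbols: "rules \<subseteq> lists symbols \<times> lists symbols"
proof -
  have "l \<in> lists symbols \<and> r \<in> lists symbols" if "(l, r) \<in> rules" for l r
    using that
  proof cases
    case (combine x y)
    then show ?thesis
      using form_lists[of x] form_lists[of y] form_lists[OF merge_closed, of x y] by auto
  next
    case (cancel x y)
    then show ?thesis
      using form_lists[of x] form_lists[of y] by auto
  qed auto
  then show ?thesis by (intro subrelI SigmaI) blast+
qed

lemma monadic_rules: "monadic symbols rules"
proof -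
  have "length l \<ge> length r \<and> r \<in> insert [] {[a] | a. a \<in> symbols}" if "(l, r) \<in> rules" for l r
    using that by cases auto
  then show ?thesis
    using rules_symbols unfolding monadic_def by blast
qed

lemma eval_form_form:
  assumes "x \<in> letters" "y \<in> letters" "isl x = isl y"
  shows "eval (form x) \<otimes>\<^bsub>P\<^esub> eval (form y) = eval (form (merge x y))"
  using assms merge_closed[of x y] cls_merge[of x y "[]" "[]"] cls_Cons[of x "[y]"]
  by (simp add: eval_form)

lemma eval_unit:
  assumes "x \<in> letters" "unit_letter x"
  shows "eval (form x) = \<one>\<^bsub>P\<^esub>"
proof -
  have "cls [] = \<one>\<^bsub>P\<^esub>" using eval_Nil by (simp add: eval_def)
  then show ?thesis using assms cls_unit[of x "[]" "[]"] by (simp add: eval_form)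
qed

lemma mult_cancel_middle:
  assumes "a \<in> carrier P" "b \<in> carrier P" "c \<in> carrier P" "d \<in> carrier P" "b \<otimes>\<^bsub>P\<^esub> c = e"
  shows "(a \<otimes>\<^bsub>P\<^esub> b) \<otimes>\<^bsub>P\<^esub> (c \<otimes>\<^bsub>P\<^esub> d) = a \<otimes>\<^bsub>P\<^esub> (e \<otimes>\<^bsub>P\<^esub> d)"
proof -
  have "b \<otimes>\<^bsub>P\<^esub> (c \<otimes>\<^bsub>P\<^esub> d) = e \<otimes>\<^bsub>P\<^esub> d"
    using assms P.m_assoc[of b c d] by simp
  then show ?thesis using assms by (simp add: P.m_assoc)
qed

text \<open>The words between control symbols lie over \<open>A \<union> B\<close>, so an occurrence
  of 0 rules out the shape with 2, and its position fixes the first factor. The companions for 1 and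
  2 work in the same way.\<close>

lemma balanced_0:
  assumes "balanced (p @ 0 # q)"
  obtains v w where "p \<in> lists (A \<union> B)" "v \<in> lists (A \<union> B)" "w \<in> lists (A \<union> B)"
    "q = v @ [1] @ w" "eval p \<otimes>\<^bsub>P\<^esub> eval v = eval (rev w)"
proof -
  have no2: "p @ 0 # q \<noteq> p' @ [2] @ q'"
    if "p' \<in> lists (A \<union> B)" "q' \<in> lists (A \<union> B)" for p' q'
  proof
    assume "p @ 0 # q = p' @ [2] @ q'"
    from arg_cong[OF this, of "\<lambda>z. 0 \<in> set z"] show False
      using separators_notin(1) that by simp
  qed
  obtain u v w where uvw: "u \<in> lists (A \<union> B)" "v \<in> lists (A \<union> B)" "w \<in> lists (A \<union> B)"
    and eq: "p @ 0 # q = u @ [0] @ v @ [1] @ w" and ev: "eval u \<otimes>\<^bsub>P\<^esub> eval v = eval (rev w)"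
    using assms no2 unfolding balanced_def by blast
  have "p = u \<and> q = v @ [1] @ w"
    using eq append_Cons_eq_iff[of 0 u "v @ [1] @ w" p q] separators_notin(1) uvw by auto
  then show ?thesis using uvw ev that by blast
qed

lemma balanced_1:
  assumes "balanced (p @ 1 # w)"
  obtains u v where "u \<in> lists (A \<union> B)" "v \<in> lists (A \<union> B)" "w \<in> lists (A \<union> B)"
    "p = u @ [0] @ v" "eval u \<otimes>\<^bsub>P\<^esub> eval v = eval (rev w)"
proof -
  have no2: "p @ 1 # w \<noteq> p' @ [2] @ q'"
    if "p' \<in> lists (A \<union> B)" "q' \<in> lists (A \<union> B)" for p' q'
  proof
    assume "p @ 1 # w = p' @ [2] @ q'"
    from arg_cong[OF this, of "\<lambda>z. 1 \<in> set z"] show False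
      using separators_notin(2) that by simp
  qed
  obtain u v x where uvx: "u \<in> lists (A \<union> B)" "v \<in> lists (A \<union> B)" "x \<in> lists (A \<union> B)"
    and eq: "p @ 1 # w = u @ [0] @ v @ [1] @ x" and ev: "eval u \<otimes>\<^bsub>P\<^esub> eval v = eval (rev x)"
    using assms no2 unfolding balanced_def by blast
  have "p = u @ [0] @ v \<and> w = x"
    using eq append_Cons_eq_iff[of 1 "u @ [0] @ v" x p w] separators_notin(2) uvx by auto
  then show ?thesis using uvx ev that by blast
qed

lemma balanced_2:
  assumes "balanced (p @ 2 # q)"
  shows "p \<in> lists (A \<union> B)" "q \<in> lists (A \<union> B)" "eval p = eval (rev q)"
proof -
  have no1: "p @ 2 # q \<noteq> u @ [0] @ v @ [1] @ w"
    if "u \<in> lists (A \<union> B)" "v \<in> lists (A \<union> B)" "w \<in> lists (A \<union> B)" for u v w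
  proof
    assume "p @ 2 # q = u @ [0] @ v @ [1] @ w"
    from arg_cong[OF this, of "\<lambda>z. 2 \<in> set z"] show False
      using separators_notin(3) that by simp
  qed
  obtain u v where uv: "u \<in> lists (A \<union> B)" "v \<in> lists (A \<union> B)"
    and eq: "p @ 2 # q = u @ [2] @ v" and ev: "eval u = eval (rev v)"
    using assms no1 unfolding balanced_def by blast
  have "p = u \<and> q = v"
    using eq append_Cons_eq_iff[of 2 u v p q] separators_notin(3) uv by auto
  then show "p \<in> lists (A \<union> B)" "q \<in> lists (A \<union> B)" "eval p = eval (rev q)"
    using uv ev by auto
qed

lemma balanced_2I:
  assumes "p \<in> lists (A \<union> B)" "q \<in> lists (A \<union> B)" "eval p = eval (rev q)"
  shows "balanced (p @ 2 # q)"
  using assms unfolding balanced_def by auto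

lemma balanced_01I:
  assumes "u \<in> lists (A \<union> B)" "v \<in> lists (A \<union> B)" "w \<in> lists (A \<union> B)"
    "eval u \<otimes>\<^bsub>P\<^esub> eval v = eval (rev w)"
  shows "balanced (u @ 0 # v @ 1 # w)"
  using assms unfolding balanced_def by (intro disjI2) auto

text \<open>Read backwards, every rule preserves the equation: \<open>cancel\<close> inserts two
  elements with product 1 around the separator, \<open>copy\<close> and \<open>peel\<close> multiply
  both sides on the right by the same letter, \<open>combine\<close> multiplies one side by two
  syllables and the other by their product, and \<open>meet\<close> introduces an empty second
  factor.\<close>

lemma balanced_rule:
  assumes "(l, r) \<in> rules" and bal: "balanced (p @ r @ q)"
  shows "balanced (p @ l @ q)"
  using assms(1)
proof cases
  case (cancel x y)
  note x = form_lists[OF cancel(3)] and y = form_lists[OF cancel(4)]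
  have "balanced (p @ 0 # q)" using bal cancel by simp
  then obtain v w where vw: "p \<in> lists (A \<union> B)" "v \<in> lists (A \<union> B)" "w \<in> lists (A \<union> B)"
    "q = v @ [1] @ w" "eval p \<otimes>\<^bsub>P\<^esub> eval v = eval (rev w)"
    by (rule balanced_0)
  have "eval (form x) \<otimes>\<^bsub>P\<^esub> eval (form y) = \<one>\<^bsub>P\<^esub>"
    using cancel(3-6) eval_form_form eval_unit merge_closed by metis
  then have "eval (p @ form x) \<otimes>\<^bsub>P\<^esub> eval (form y @ v) = eval (rev w)"
    using vw x y mult_cancel_middle[OF eval_closed eval_closed eval_closed eval_closed]
    by (simp add: eval_append eval_closed)
  then have "balanced ((p @ form x) @ 0 # (form y @ v) @ 1 # w)"
    using vw x y by (intro balanced_01I) auto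
  then show ?thesis using cancel vw by simp
next
  case (copy a)
  have "balanced (p @ 1 # q)" using bal copy by simp
  then obtain u v where uv: "u \<in> lists (A \<union> B)" "v \<in> lists (A \<union> B)" "q \<in> lists (A \<union> B)"
    "p = u @ [0] @ v" "eval u \<otimes>\<^bsub>P\<^esub> eval v = eval (rev q)"
    by (rule balanced_1)
  have a: "[a] \<in> lists (A \<union> B)" and q: "rev q \<in> lists (A \<union> B)" using copy uv by auto
  have "eval u \<otimes>\<^bsub>P\<^esub> eval (v @ [a]) = (eval u \<otimes>\<^bsub>P\<^esub> eval v) \<otimes>\<^bsub>P\<^esub> eval [a]"
    using uv(1-3) a by (simp add: eval_append eval_closed P.m_assoc)
  also have "\<dots> = eval (rev (a # q))"
    using uv q a by (simp add: eval_append)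
  finally have "balanced (u @ 0 # (v @ [a]) @ 1 # a # q)"
    using uv a by (intro balanced_01I) auto
  then show ?thesis using copy uv by simp
next
  case (combine x y)
  note x = form_lists[OF combine(3)] and y = form_lists[OF combine(4)]
    and xy = form_lists[OF merge_closed[OF combine(3,4)]]
  have "balanced (p @ 2 # q)" using bal combine by simp
  note pq = balanced_2[OF this]
  then have q: "rev q \<in> lists (A \<union> B)" by simp
  have "eval (p @ form x) \<otimes>\<^bsub>P\<^esub> eval (form y)
      = eval p \<otimes>\<^bsub>P\<^esub> eval (form (merge x y))"
    using pq x y eval_form_form[OF combine(3-5)]
    by (simp add: eval_append eval_closed P.m_assoc)
  also have "\<dots> = eval (rev (rev (form (merge x y)) @ q))"
    using pq q xy by (simp add: eval_append)
  finally have "balanced ((p @ form x) @ 0 # form y @ 1 # rev (form (merge x y)) @ q)"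
    using pq x y xy by (intro balanced_01I) auto
  then show ?thesis using combine by simp
next
  case meet
  have "balanced (p @ 2 # q)" using bal meet by simp
  note pq = balanced_2[OF this]
  have "balanced (p @ 0 # [] @ 1 # q)"
    using pq by (intro balanced_01I) (simp_all add: eval_Nil eval_closed flip: pq(3))
  then show ?thesis using meet by simp
next
  case (peel a)
  have "balanced (p @ 2 # q)" using bal peel by simp
  note pq = balanced_2[OF this]
  have a: "[a] \<in> lists (A \<union> B)" and q: "rev q \<in> lists (A \<union> B)" using peel pq by auto
  have "eval (p @ [a]) = eval (rev (a # q))"
    using pq q a by (simp add: eval_append)
  then have "balanced ((p @ [a]) @ 2 # a # q)"
    using pq a by (intro balanced_2I) auto
  then show ?thesis using peel by simp
qed

lemma balanced_ancestors:
  assumes "z \<in> ancestors symbols rules {[2]}"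
  shows "balanced z"
proof -
  have "(rewrite_step symbols rules)\<^sup>*\<^sup>* z [2]"
    using assms by (simp add: ancestors_def)
  then show ?thesis
  proof (induction rule: converse_rtranclp_induct)
    case base
    show ?case using balanced_2I[of "[]" "[]"] by simp
  next
    case (step y z)
    then show ?case
      using balanced_rule unfolding rewrite_step_def by blast
  qed
qed

section \<open>Completeness: every entry of the multiplication table derives
  \<open>[2]\<close>\<close>

abbreviation derives :: "nat list \<Rightarrow> nat list \<Rightarrow> bool" where
  "derives \<equiv> (rewrite_step symbols rules)\<^sup>*\<^sup>*"

lemma derives_rule:
  assumes "(l, r) \<in> rules" "p \<in> lists symbols" "q \<in> lists symbols"
  shows "derives (p @ l @ q) (p @ r @ q)"
  using assms unfolding rewrite_step_def by (intro r_into_rtranclp) blast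

lemma lists_symbols: "w \<in> lists (A \<union> B) \<Longrightarrow> w \<in> lists symbols"
  by auto

lemma derives_peel:
  assumes "w \<in> lists (A \<union> B)"
  shows "derives (w @ [2] @ rev w) [2]"
  using assms
proof (induction w rule: rev_induct)
  case (snoc a w)
  then have "derives (w @ [a, 2, a] @ rev w) (w @ [2] @ rev w)"
    by (intro derives_rule rules.peel) auto
  with snoc show ?case by simp
qed simp

lemma derives_copy:
  assumes "w \<in> lists (A \<union> B)" "p \<in> lists symbols" "q \<in> lists symbols"
  shows "derives (p @ w @ [1] @ rev w @ q) (p @ [1] @ q)"
  using assms(1)
proof (induction w rule: rev_induct)
  case (snoc a w)
  then have "derives ((p @ w) @ [a, 1, a] @ (rev w @ q)) ((p @ w) @ [1] @ rev w @ q)"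
    using assms(2,3) by (intro derives_rule rules.copy) auto
  with snoc show ?case by simp
qed simp

text \<open>Serves for products whose normal form is the plain concatenation. \<open>v\<close> is
  matched against the inner part of the mirrored result, the separators meet, and \<open>u\<close>
  is matched against the rest.\<close>

lemma derives_concatenation:
  assumes "u \<in> lists (A \<union> B)" "v \<in> lists (A \<union> B)"
  shows "derives (u @ [0] @ v @ [1] @ rev (u @ v)) [2]"
proof -
  have "derives ((u @ [0]) @ v @ [1] @ rev v @ rev u) ((u @ [0]) @ [1] @ rev u)"
    using assms by (intro derives_copy) auto
  also have "derives ((u @ [0]) @ [1] @ rev u) (u @ [2] @ rev u)"
    using derives_rule[OF rules.meet, of u "rev u"] assms(1)[THEN lists_symbols]
    by (simp add: rev_in_lists)
  also have "derives (u @ [2] @ rev u) [2]"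
    using assms(1) by (rule derives_peel)
  finally show ?thesis by simp
qed

text \<open>Only the end of \<open>l\<close> touches the separator, hence the induction from the
  right; \<open>k\<close> varies because cancelling removes its first syllable as well.\<close>

lemma derives_product:
  assumes "alternating l" "alternating k"
  shows "derives (encode l @ [0] @ encode k @ [1] @ rev (encode (reduce (l @ k)))) [2]"
  using assms
proof (induction l arbitrary: k rule: rev_induct)
  case Nil
  then show ?case
    using derives_concatenation[of "[]" "encode k"] encode_lists[OF alternating_letters, of k]
    by (simp add: reduce_id)
next
  case (snoc x l)
  have lists: "encode (l @ [x]) \<in> lists (A \<union> B)" "encode k \<in> lists (A \<union> B)"
    using encode_lists[OF alternating_letters] snoc.prems by blast+
  show ?case
  proof (cases "alternating ((l @ [x]) @ k)")
    case True
    then show ?thesis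
      using derives_concatenation[OF lists] by (simp add: reduce_id)
  next
    case False
    \<comment> \<open>Both words alternate, so the failure sits at the junction: \<open>k\<close> is
      nonempty and starts in the factor of \<open>x\<close>.\<close>
    then obtain y k' where k: "k = y # k'" and xy: "isl x = isl y"
      using snoc.prems by (cases k) (auto simp: alternating_def successively_append_iff)
    have mem: "x \<in> letters" "y \<in> letters" and alt: "alternating l" "alternating k'"
      and ll: "l \<in> lists letters" "k' \<in> lists letters"
      using snoc.prems by (auto simp: k alternating_def successively_append_iff successively_Cons)
    have el: "encode l \<in> lists (A \<union> B)" "encode k' \<in> lists (A \<union> B)"
      using encode_lists ll by blast+
    note forms = form_lists[OF mem(1)] form_lists[OF mem(2)] form_lists[OF merge_closed[OF mem]]
    have red: "reduce ((l @ [x]) @ k) = reduce (l @ [merge x y] @ k')"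
      using reduce_merge[OF mem xy ll(2), of l] by (simp add: k)
    show ?thesis
    proof (cases "unit_letter (merge x y)")
      case True
      then have red: "reduce ((l @ [x]) @ k) = reduce (l @ k')"
        using red reduce_unit[OF True ll(2), of l] by simp
      have "encode (reduce (l @ k')) \<in> lists (A \<union> B)"
        using encode_lists[OF alternating_letters[OF reduce_alternating]] ll by simp
      then have "derives
          (encode l @ (form x @ [0] @ form y) @ (encode k' @ [1] @ rev (encode (reduce (l @ k')))))
          (encode l @ [0] @ (encode k' @ [1] @ rev (encode (reduce (l @ k')))))"
        using el by (intro derives_rule rules.cancel mem xy True) auto
      also have "derives \<dots> [2]"
        using snoc.IH[OF alt] by simp
      finally show ?thesis unfolding red by (simp add: k)
    next
      case nonunit: False
      \<comment> \<open>A nonunit product stays in the factor of \<open>x\<close> and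
        \<open>y\<close>, so it alternates with its neighbours and the interaction stops
        here.\<close>
      have "alternating (l @ [merge x y] @ k')"
        using snoc.prems merge_closed[OF mem] nonunit xy
        by (auto simp: k alternating_def successively_append_iff successively_Cons)
      then have red: "reduce ((l @ [x]) @ k) = l @ [merge x y] @ k'"
        using red by (simp add: reduce_id)
      let ?p = "encode l @ form x @ [0] @ form y"
        and ?q = "rev (form (merge x y)) @ rev (encode l)"
      \<comment> \<open>The copying has to precede \<open>combine\<close>, which needs the second
        syllable directly in front of 1.\<close>
      have copied: "derives (?p @ encode k' @ [1] @ rev (encode k') @ ?q) (?p @ [1] @ ?q)"
        using el forms by (intro derives_copy) auto
      have "derives (encode l @ (form x @ [0] @ form y @ [1] @ rev (form (merge x y))) @ rev (encode l))
          (encode l @ [2] @ rev (encode l))"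
        using el by (intro derives_rule rules.combine mem xy) auto
      from rtranclp_trans[OF this derives_peel[OF el(1)]]
      have "derives (?p @ [1] @ ?q) [2]" by simp
      from rtranclp_trans[OF copied this] show ?thesis
        unfolding red by (simp add: k)
    qed
  qed
qed

lemma mult_table_eq_ancestors:
  "mult_table P eval 0 1 forms = ancestors symbols rules {[2]} \<inter>
     lang_conc forms (lang_conc {[0]} (lang_conc forms (lang_conc {[1]} (rev ` forms))))"
proof (intro subset_antisym subsetI)
  fix z assume "z \<in> mult_table P eval 0 1 forms"
  then obtain u v w where uvw: "u \<in> forms" "v \<in> forms" "w \<in> forms"
    and z: "z = u @ [0] @ v @ [1] @ rev w" and prod: "eval u \<otimes>\<^bsub>P\<^esub> eval v = eval w"
    unfolding mult_table_def by blast
  obtain l k where l: "alternating l" "u = encode l" and k: "alternating k" "v = encode k"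
    using uvw unfolding forms_def by blast
  have lk: "l @ k \<in> lists letters"
    using alternating_letters l(1) k(1) by simp
  note alt = reduce_alternating[OF lk]
  have "eval (u @ v) = cls (l @ k)"
    using eval_encode[OF lk] by (simp add: l k)
  moreover have "eval (u @ v) = eval w"
    using eval_append[OF subsetD[OF forms_lists uvw(1)] subsetD[OF forms_lists uvw(2)]] prod by simp
  moreover have "eval (encode (reduce (l @ k))) = cls (l @ k)"
    using eval_encode[OF alternating_letters[OF alt]] cls_reduce[OF lk] by simp
  moreover have "encode (reduce (l @ k)) \<in> forms"
    using alt unfolding forms_def by blast
  \<comment> \<open>Both sides are normal forms of the same element, so
    \<open>derives_product\<close>, which speaks of the reduced result only, applies to the given
    \<open>w\<close>.\<close>
  ultimately have "w = encode (reduce (l @ k))"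
    using uvw(3) forms_representative[OF eval_closed[OF subsetD[OF forms_lists uvw(3)]]] by auto
  then have "derives z [2]"
    using derives_product[OF l(1) k(1)] by (simp add: z l k)
  moreover have "z \<in> lists symbols"
    using subsetD[OF forms_lists uvw(1)] subsetD[OF forms_lists uvw(2)] subsetD[OF forms_lists uvw(3)]
    by (auto simp: z)
  ultimately have "z \<in> ancestors symbols rules {[2]}"
    by (simp add: ancestors_def)
  moreover have "z \<in> lang_conc forms (lang_conc {[0]} (lang_conc forms (lang_conc {[1]} (rev ` forms))))"
    unfolding z by (intro append_in_lang_conc imageI uvw) simp_all
  ultimately show "z \<in> ancestors symbols rules {[2]} \<inter>
     lang_conc forms (lang_conc {[0]} (lang_conc forms (lang_conc {[1]} (rev ` forms))))"
    by blast
next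
  fix z assume z: "z \<in> ancestors symbols rules {[2]} \<inter>
     lang_conc forms (lang_conc {[0]} (lang_conc forms (lang_conc {[1]} (rev ` forms))))"
  then obtain u v w where uvw: "u \<in> forms" "v \<in> forms" "w \<in> forms"
    and eq: "z = u @ [0] @ v @ [1] @ rev w"
    unfolding lang_conc_def by blast
  note lists = subsetD[OF forms_lists uvw(1)] subsetD[OF forms_lists uvw(2)] subsetD[OF forms_lists uvw(3)]
  have "balanced z" using z balanced_ancestors by blast
  then have "balanced (u @ 0 # (v @ [1] @ rev w))" by (simp add: eq)
  then obtain v' w' where "v @ [1] @ rev w = v' @ [1] @ w'" "v' \<in> lists (A \<union> B)" "w' \<in> lists (A \<union> B)"
    and ev: "eval u \<otimes>\<^bsub>P\<^esub> eval v' = eval (rev w')"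
    by (rule balanced_0)
  \<comment> \<open>The symbol 1 occurs only once, so the splitting supplied by the invariant is the
    one into normal forms.\<close>
  then have "v' = v" "w' = rev w"
    using append_Cons_eq_iff[of 1 v "rev w" v' w'] separators_notin(2) lists by auto
  with ev have "eval u \<otimes>\<^bsub>P\<^esub> eval v = eval w" by simp
  then show "z \<in> mult_table P eval 0 1 forms"
    unfolding mult_table_def eq using uvw by blast
qed

section \<open>Membership of the left-hand sides in the class\<close>

lemma combine_lefthand_sides:
  "{form x @ [0] @ form y @ [1] @ rev (form (merge x y)) | x y.
      x \<in> letters \<and> y \<in> letters \<and> isl x = isl y}
   = mult_table M \<alpha> 0 1 R \<union> mult_table N \<beta> 0 1 S" (is "?K = _")
proof (intro subset_antisym subsetI)
  fix z assume "z \<in> ?K"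
  then obtain x y where z: "z = form x @ [0] @ form y @ [1] @ rev (form (merge x y))"
    and xy: "x \<in> letters" "y \<in> letters" "isl x = isl y" by blast
  consider a b where "x = Inl a" "y = Inl b" "a \<in> carrier M" "b \<in> carrier M"
    | a b where "x = Inr a" "y = Inr b" "a \<in> carrier N" "b \<in> carrier N"
    using xy by auto
  then show "z \<in> mult_table M \<alpha> 0 1 R \<union> mult_table N \<beta> 0 1 S"
  proof cases
    case 1
    have "z \<in> mult_table M \<alpha> 0 1 R"
      unfolding mult_table_def z mem_Collect_eq
      by (intro exI conjI, rule refl) (use 1 form_Inl in simp_all)
    then show ?thesis by blast
  next
    case 2
    have "z \<in> mult_table N \<beta> 0 1 S"
      unfolding mult_table_def z mem_Collect_eq
      by (intro exI conjI, rule refl) (use 2 form_Inr in simp_all)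
    then show ?thesis by blast
  qed
next
  fix z assume "z \<in> mult_table M \<alpha> 0 1 R \<union> mult_table N \<beta> 0 1 S"
  then consider u v w where "u \<in> R" "v \<in> R" "w \<in> R" "\<alpha> u \<otimes>\<^bsub>M\<^esub> \<alpha> v = \<alpha> w" "z = u @ [0] @ v @ [1] @ rev w"
    | u v w where "u \<in> S" "v \<in> S" "w \<in> S" "\<beta> u \<otimes>\<^bsub>N\<^esub> \<beta> v = \<beta> w" "z = u @ [0] @ v @ [1] @ rev w"
    unfolding mult_table_def by blast
  then show "z \<in> ?K"
  proof cases
    case 1
    then have "\<alpha> u \<in> carrier M" "\<alpha> v \<in> carrier M"
      using \<alpha>_simps(1) R_lists by blast+
    then show ?thesis
      unfolding mem_Collect_eq
      by (intro exI[of _ "Inl (\<alpha> u)"] exI[of _ "Inl (\<alpha> v)"]) (simp add: 1 form_\<alpha> InlI)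
  next
    case 2
    then have "\<beta> u \<in> carrier N" "\<beta> v \<in> carrier N"
      using \<beta>_simps(1) S_lists by blast+
    then show ?thesis
      unfolding mem_Collect_eq
      by (intro exI[of _ "Inr (\<beta> u)"] exI[of _ "Inr (\<beta> v)"]) (simp add: 2 form_\<beta> InrI)
  qed
qed

text \<open>That a product is the unit shows in the table as a third component equal to the normal
  form of the unit. Hence these left-hand sides form right quotients of the two tables by fixed
  words, to which \<open>right_quotient_word\<close> applies.\<close>

lemma cancel_lefthand_sides:
  "{form x @ [0] @ form y | x y.
      x \<in> letters \<and> y \<in> letters \<and> isl x = isl y \<and> unit_letter (merge x y)}
   = {u. u @ [1] @ rev (form (Inl \<one>\<^bsub>M\<^esub>)) \<in> mult_table M \<alpha> 0 1 R} \<union>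
     {u. u @ [1] @ rev (form (Inr \<one>\<^bsub>N\<^esub>)) \<in> mult_table N \<beta> 0 1 S}" (is "?K = ?L")
proof (intro subset_antisym subsetI)
  fix z assume "z \<in> ?K"
  then obtain x y where z: "z = form x @ [0] @ form y"
    and xy: "x \<in> letters" "y \<in> letters" "isl x = isl y" "unit_letter (merge x y)" by blast
  consider a b where "x = Inl a" "y = Inl b" "a \<in> carrier M" "b \<in> carrier M" "a \<otimes>\<^bsub>M\<^esub> b = \<one>\<^bsub>M\<^esub>"
    | a b where "x = Inr a" "y = Inr b" "a \<in> carrier N" "b \<in> carrier N" "a \<otimes>\<^bsub>N\<^esub> b = \<one>\<^bsub>N\<^esub>"
    using xy by (auto simp: unit_letter_def)
  then show "z \<in> ?L"
  proof cases
    case 1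
    have "z @ [1] @ rev (form (Inl \<one>\<^bsub>M\<^esub>)) \<in> mult_table M \<alpha> 0 1 R"
      unfolding mult_table_def z mem_Collect_eq append_assoc
      by (intro exI conjI, rule refl) (use 1 form_Inl in simp_all)
    then show ?thesis by blast
  next
    case 2
    have "z @ [1] @ rev (form (Inr \<one>\<^bsub>N\<^esub>)) \<in> mult_table N \<beta> 0 1 S"
      unfolding mult_table_def z mem_Collect_eq append_assoc
      by (intro exI conjI, rule refl) (use 2 form_Inr in simp_all)
    then show ?thesis by blast
  qed
next
  \<comment> \<open>The stripped suffix contains the only occurrence of 1, so the quotient cannot
    cut into the two factors.\<close>
  have split: "z = u @ [0] @ v \<and> e = w"
    if "z @ [1] @ rev e = u @ [0] @ v @ [1] @ rev w"
      "u \<in> lists (A \<union> B)" "v \<in> lists (A \<union> B)" "w \<in> lists (A \<union> B)" for z e u v w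
    using that append_Cons_eq_iff[of 1 "u @ [0] @ v" "rev w" z "rev e"] separators_notin(2) by auto
  fix z assume "z \<in> ?L"
  then consider u v w where "u \<in> R" "v \<in> R" "w \<in> R" "\<alpha> u \<otimes>\<^bsub>M\<^esub> \<alpha> v = \<alpha> w"
      "z @ [1] @ rev (form (Inl \<one>\<^bsub>M\<^esub>)) = u @ [0] @ v @ [1] @ rev w"
    | u v w where "u \<in> S" "v \<in> S" "w \<in> S" "\<beta> u \<otimes>\<^bsub>N\<^esub> \<beta> v = \<beta> w"
      "z @ [1] @ rev (form (Inr \<one>\<^bsub>N\<^esub>)) = u @ [0] @ v @ [1] @ rev w"
    unfolding mult_table_def by blast
  then show "z \<in> ?K"
  proof cases
    case 1
    then have lists: "u \<in> lists A" "v \<in> lists A" "w \<in> lists A"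
      using R_lists by blast+
    then have "z = u @ [0] @ v" "form (Inl \<one>\<^bsub>M\<^esub>) = w"
      using split[OF 1(5)] by auto
    then have "z = form (Inl (\<alpha> u)) @ [0] @ form (Inl (\<alpha> v))" "\<alpha> u \<otimes>\<^bsub>M\<^esub> \<alpha> v = \<one>\<^bsub>M\<^esub>"
      using 1 form_Inl[OF M.one_closed] by (simp_all add: form_\<alpha>)
    then show ?thesis
      unfolding mem_Collect_eq using lists \<alpha>_simps(1)
      by (intro exI[of _ "Inl (\<alpha> u)"] exI[of _ "Inl (\<alpha> v)"])
        (simp add: InlI unit_letter_def)
  next
    case 2
    then have lists: "u \<in> lists B" "v \<in> lists B" "w \<in> lists B"
      using S_lists by blast+
    then have "z = u @ [0] @ v" "form (Inr \<one>\<^bsub>N\<^esub>) = w"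
      using split[OF 2(5)] by auto
    then have "z = form (Inr (\<beta> u)) @ [0] @ form (Inr (\<beta> v))" "\<beta> u \<otimes>\<^bsub>N\<^esub> \<beta> v = \<one>\<^bsub>N\<^esub>"
      using 2 form_Inr[OF N.one_closed] by (simp_all add: form_\<beta>)
    then show ?thesis
      unfolding mem_Collect_eq using lists \<beta>_simps(1)
      by (intro exI[of _ "Inr (\<beta> u)"] exI[of _ "Inr (\<beta> v)"])
        (simp add: InrI unit_letter_def)
  qed
qed

inductive_simps rules_simps:
  "(u, [0]) \<in> rules" "(u, [1]) \<in> rules" "(u, [2]) \<in> rules"

text \<open>Sorted by right-hand side: 0 has quotients of the tables, 1 a finite set, 2 the tables
  together with a finite set. Every other right-hand side has no rule, and the empty language
  belongs to the class.\<close>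

lemma class_monadic_rules:
  assumes "nontrivial_full_AFL C"
    and T: "mult_table M \<alpha> 0 1 R \<in> C" "mult_table N \<beta> 0 1 S \<in> C"
  shows "class_monadic C symbols rules"
proof -
  interpret nontrivial_full_AFL C by fact
  have fin: "finite (A \<union> B)" using finite_A finite_B by simp
  have lhs: "{u. (u, [0]) \<in> rules} = {form x @ [0] @ form y | x y.
      x \<in> letters \<and> y \<in> letters \<and> isl x = isl y \<and> unit_letter (merge x y)}"
    "{u. (u, [1]) \<in> rules} = (\<lambda>a. [a, 1, a]) ` (A \<union> B)"
    "{u. (u, [2]) \<in> rules} = {form x @ [0] @ form y @ [1] @ rev (form (merge x y)) | x y.
      x \<in> letters \<and> y \<in> letters \<and> isl x = isl y} \<union> insert [0, 1] ((\<lambda>a. [a, 2, a]) ` (A \<union> B))"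
    unfolding rules_simps append_Cons append_Nil by blast+
  have other: "{u. (u, v) \<in> rules} = {}" if "v \<notin> {[0], [1], [2]}" for v
    using that by (auto elim: rules.cases)
  have "{u. (u, [0]) \<in> rules} \<in> C"
    unfolding lhs cancel_lefthand_sides by (intro Un_closed right_quotient_word T)
  moreover have "{u. (u, [1]) \<in> rules} \<in> C"
    unfolding lhs using fin by (intro finite_in_class finite_imageI)
  moreover have "{u. (u, [2]) \<in> rules} \<in> C"
    unfolding lhs combine_lefthand_sides using fin
    by (intro Un_closed T finite_in_class finite.insertI finite_imageI)
  ultimately have "{u. (u, v) \<in> rules} \<in> C" for v
    using other[of v] finite_in_class[OF finite.emptyI] by (cases "v \<in> {[0], [1], [2]}") auto
  then show ?thesis
    unfolding class_monadic_def using monadic_rules by blast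
qed

lemma tabled_free_product:
  assumes C: "super_AFL C"
    and T: "mult_table M \<alpha> 0 1 R \<in> C" "mult_table N \<beta> 0 1 S \<in> C"
  shows "tabled C P"
proof -
  \<comment> \<open>The entry for 1 times 1 is a witness that the class has a nonempty member;
    finite languages such as \<open>{[2]}\<close> are then available.\<close>
  have "form (Inl \<one>\<^bsub>M\<^esub>) @ [0] @ form (Inl \<one>\<^bsub>M\<^esub>) @ [1] @ rev (form (Inl \<one>\<^bsub>M\<^esub>)) \<in> mult_table M \<alpha> 0 1 R"
    unfolding mult_table_def mem_Collect_eq
    by (intro exI conjI, rule refl) (simp_all add: form_Inl)
  then interpret nontrivial_full_AFL C
    using C T(1) by unfold_locales (auto simp: super_AFL_def)
  have "ancestors symbols rules {[2]} \<in> C"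
  proof -
    have "class_monadic C symbols rules"
      using T by (rule class_monadic_rules[OF nontrivial_full_AFL_axioms])
    moreover have "finite symbols" "{[2]} \<subseteq> lists symbols" "{[2]} \<in> C"
      using finite_A finite_B finite_in_class by auto
    ultimately show ?thesis
      using C[unfolded super_AFL_def monadic_ancestor_property_def, THEN conjunct2, rule_format]
      by simp
  qed
  then have "mult_table P eval 0 1 forms \<in> C"
    unfolding mult_table_eq_ancestors
    by (rule Int_regular)
      (intro regular.conc regular_forms regular_rev regular_singleton)
  moreover have "finite (A \<union> B)" "0 \<notin> A \<union> B" "1 \<notin> A \<union> B" "(0 :: nat) \<noteq> 1"
    using finite_A finite_B separators by auto
  ultimately show ?thesis
    unfolding tabled_def using eval_hom eval_surj normal_forms_free_product
    by (intro exI[of _ "A \<union> B"] exI[of _ eval] exI[of _ forms] exI[of _ 0] exI[of _ 1] conjI)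
qed

end

theorem theorem2:
  fixes C :: "nat list set set"
    and M\<^sub>1 :: "('a, 'm) monoid_scheme" and M\<^sub>2 :: "('b, 'n) monoid_scheme"
  assumes "super_AFL C" and "reversal_closed C"
    and "monoid M\<^sub>1" and "monoid M\<^sub>2"
    and "tabled C M\<^sub>1" and "tabled C M\<^sub>2"
  shows "tabled C (free_product M\<^sub>1 M\<^sub>2)"
proof -
  interpret M: monoid M\<^sub>1 by fact
  \<comment> \<open>\<open>tabled_renaming\<close> lives in the locale of nontrivial classes, so a
    nonempty member is exhibited before the alphabets are renamed.\<close>
  have "\<exists>L\<in>C. L \<noteq> {}"
  proof -
    obtain A \<pi> R s t where \<pi>: "\<pi> \<in> monoid_hom (free_monoid A) M\<^sub>1"
      and nf: "normal_forms M\<^sub>1 A \<pi> R" and T: "mult_table M\<^sub>1 \<pi> s t R \<in> C"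
      using assms(5) unfolding tabled_def by (elim exE conjE)
    have "\<exists>!w. w \<in> R \<and> \<pi> w = \<one>\<^bsub>M\<^sub>1\<^esub>"
      using nf by (simp add: normal_forms_def)
    then obtain w where "w \<in> R" "\<pi> w = \<one>\<^bsub>M\<^sub>1\<^esub>" by blast
    then have "w @ [s] @ w @ [t] @ rev w \<in> mult_table M\<^sub>1 \<pi> s t R"
      unfolding mult_table_def mem_Collect_eq
      by (intro exI[of _ w] conjI refl) (simp_all add: M.one_closed)
    then show ?thesis using T by blast
  qed
  then interpret nontrivial_full_AFL C
    using assms(1) by unfold_locales (simp_all add: super_AFL_def)
  \<comment> \<open>Parity makes the two alphabets disjoint, and the offsets 3 and 4 keep them clear
    of the control symbols 0, 1 and 2.\<close>
  have f: "inj (\<lambda>a::nat. 2 * a + 3)" "inj (\<lambda>a::nat. 2 * a + 4)"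
    by (simp_all add: inj_on_def)
  obtain A \<alpha> R where A: "finite A" "A \<subseteq> range (\<lambda>a. 2 * a + 3)"
    "\<alpha> \<in> monoid_hom (free_monoid A) M\<^sub>1" "normal_forms M\<^sub>1 A \<alpha> R" "mult_table M\<^sub>1 \<alpha> 0 1 R \<in> C"
    by (rule tabled_renaming[OF assms(5) f(1)]) auto
  obtain B \<beta> S where B: "finite B" "B \<subseteq> range (\<lambda>a. 2 * a + 4)"
    "\<beta> \<in> monoid_hom (free_monoid B) M\<^sub>2" "normal_forms M\<^sub>2 B \<beta> S" "mult_table M\<^sub>2 \<beta> 0 1 S \<in> C"
    by (rule tabled_renaming[OF assms(6) f(2)]) auto
  have "2 * a + 3 \<noteq> 2 * b + 4" for a b :: nat by presburger
  then have "A \<inter> B = {}" using A(2) B(2) by blast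
  moreover have "{0, 1, 2} \<inter> (A \<union> B) = {}" using A(2) B(2) by auto
  ultimately interpret two_tables M\<^sub>1 M\<^sub>2 A B \<alpha> \<beta> R S
    using A B assms(3,4) by (intro two_tables.intro two_monoids.intro two_tables_axioms.intro)
  show ?thesis
    using assms(1) A(5) B(5) by (rule tabled_free_product)
qed

end
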